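(* Let $G$ be a fixed edge-weighted graph that can be $(s,t)$-covered. Then $f(G;n)\lesssim n^{\frac43 s+2t}$, and if all edge weights of $G$ are nonzero, $g(G;n)\lesssim n^{\frac43 s+2t}$.
   Context: $P_k$ denotes the path with $k$ vertices (and $k-1$ edges). A graph $G$ can be $(s,t)$-covered if there are $s$ copies of $P_2$ and $t$ copies of $P_3$ as subgraphs of $G$, pairwise vertex-disjoint, whose vertex sets together cover all of $V(G)$ (so $|V(G)|=2s+3t$). For an edge-weighted graph $G$ on $m$ vertices with weight function $w$, an $m$-tuple $X$ of points in $\mathbb R^2$ is a distance (resp. dot product) $G$-configuration if there is a bijection $\varphi:V(G)\to X$ with $|\varphi(u)-\varphi(v)|=w(\{u,v\})$ (resp. $\varphi(u)\cdot\varphi(v)=w(\{u,v\})$) for all edges $\{u,v\}$. $f(G;n)$ (resp. $g(G;n)$) is the maximum over all $n$-point sets in $\mathbb R^2$ of the number of distance (resp. dot product) $G$-configurations in the set. $X(n)\lesssim Y(n)$ means $X(n)\le CY(n)$ for $n>N$ with $C,N$ independent of $n$. *)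

theory Defs
  imports "HOL-Analysis.Analysis"
begin

section \<open>Finite simple graphs\<close>

type_synonym 'v graph = "'v set \<times> 'v set set"

abbreviation verts :: "'v graph \<Rightarrow> 'v set" where "verts \<equiv> fst"
abbreviation edges :: "'v graph \<Rightarrow> 'v set set" where "edges \<equiv> snd"

definition simple_graph :: "'v graph \<Rightarrow> bool" where
  "simple_graph G \<longleftrightarrow> finite (verts G) \<and> (\<forall>e\<in>edges G. e \<subseteq> verts G \<and> card e = 2)"

definition graph_iso :: "'u graph \<Rightarrow> 'v graph \<Rightarrow> bool" where
  "graph_iso K H \<longleftrightarrow>
     (\<exists>\<phi>. bij_betw \<phi> (verts K) (verts H) \<and> edges H = (\<lambda>e. \<phi> ` e) ` edges K)"

definition subgraph :: "'v graph \<Rightarrow> 'v graph \<Rightarrow> bool" where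
  "subgraph H G \<longleftrightarrow> simple_graph H \<and> verts H \<subseteq> verts G \<and> edges H \<subseteq> edges G"

definition path_graph :: "nat \<Rightarrow> nat graph" where
  "path_graph k = ({..<k}, {{i, Suc i} | i. Suc i < k})"

definition copy_in :: "'u graph \<Rightarrow> 'v graph \<Rightarrow> 'v graph \<Rightarrow> bool" where
  "copy_in K G H \<longleftrightarrow> subgraph H G \<and> graph_iso K H"

definition can_be_covered :: "nat \<Rightarrow> nat \<Rightarrow> 'v graph \<Rightarrow> bool" where
  "can_be_covered s t G \<longleftrightarrow>
     (\<exists>A B. finite A \<and> card A = s \<and> (\<forall>H\<in>A. copy_in (path_graph 2) G H) \<and>
            finite B \<and> card B = t \<and> (\<forall>H\<in>B. copy_in (path_graph 3) G H) \<and>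
            (\<forall>H\<in>A \<union> B. \<forall>H'\<in>A \<union> B. H \<noteq> H' \<longrightarrow> verts H \<inter> verts H' = {}) \<and>
            (\<Union>H\<in>A \<union> B. verts H) = verts G)"

section \<open>Configurations\<close>

text \<open>Tuples are ordered (lists). Since \<open>\<phi>\<close> is a bijection from the vertices onto the set of
  points of \<open>X\<close> and \<open>X\<close> has as many entries as there are vertices, the entries of \<open>X\<close> are
  distinct. The weight function matters only on edges.\<close>

definition distance_config :: "'v graph \<Rightarrow> ('v set \<Rightarrow> real) \<Rightarrow> (real^2) list \<Rightarrow> bool" where
  "distance_config G w X \<longleftrightarrow> length X = card (verts G) \<and>
     (\<exists>\<phi>. bij_betw \<phi> (verts G) (set X) \<and>
          (\<forall>u v. {u, v} \<in> edges G \<longrightarrow> norm (\<phi> u - \<phi> v) = w {u, v}))"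

definition dot_config :: "'v graph \<Rightarrow> ('v set \<Rightarrow> real) \<Rightarrow> (real^2) list \<Rightarrow> bool" where
  "dot_config G w X \<longleftrightarrow> length X = card (verts G) \<and>
     (\<exists>\<phi>. bij_betw \<phi> (verts G) (set X) \<and>
          (\<forall>u v. {u, v} \<in> edges G \<longrightarrow> \<phi> u \<bullet> \<phi> v = w {u, v}))"

definition max_distance_configs :: "'v graph \<Rightarrow> ('v set \<Rightarrow> real) \<Rightarrow> nat \<Rightarrow> nat" where
  "max_distance_configs G w n =
     Max {card {X. set X \<subseteq> P \<and> distance_config G w X} | P. finite P \<and> card P = n}"

definition max_dot_configs :: "'v graph \<Rightarrow> ('v set \<Rightarrow> real) \<Rightarrow> nat \<Rightarrow> nat" where
  "max_dot_configs G w n =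
     Max {card {X. set X \<subseteq> P \<and> dot_config G w X} | P. finite P \<and> card P = n}"

definition lesssim :: "(nat \<Rightarrow> real) \<Rightarrow> (nat \<Rightarrow> real) \<Rightarrow> bool" (infix "\<lesssim>" 50) where
  "F \<lesssim> H \<longleftrightarrow> (\<exists>C N. \<forall>n>N. F n \<le> C * H n)"

text \<open>Both maxima are taken over finite nonempty sets of numbers.\<close>

lemma config_counts_finite:
  fixes R :: "'a list \<Rightarrow> bool"
  assumes len: "\<And>X. R X \<Longrightarrow> length X = m"
  shows "finite {card {X. set X \<subseteq> P \<and> R X} | P. finite P \<and> card P = n}"
proof (rule finite_subset)
  show "{card {X. set X \<subseteq> P \<and> R X} | P. finite P \<and> card P = n} \<subseteq> {..n ^ m}"
  proof clarsimp
    fix P :: "'a set" assume P: "finite P"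
    have "card {X. set X \<subseteq> P \<and> R X} \<le> card {X. set X \<subseteq> P \<and> length X = m}"
      using len by (intro card_mono finite_lists_length_eq P) auto
    then show "card {X. set X \<subseteq> P \<and> R X} \<le> card P ^ m"
      by (simp add: card_lists_length_eq P)
  qed
qed simp

lemma exists_planar_point_set: "\<exists>P :: (real^2) set. finite P \<and> card P = n"
proof -
  have "infinite (UNIV :: (real^2) set)"
    using finite_imp_bounded not_bounded_UNIV by blast
  from infinite_arbitrarily_large[OF this, of n] show ?thesis by auto
qed

lemma distance_config_counts:
  "finite {card {X. set X \<subseteq> P \<and> distance_config G w X} | P. finite P \<and> card P = n}"
  "{card {X. set X \<subseteq> P \<and> distance_config G w X} | P. finite P \<and> card P = n} \<noteq> {}"
proof -
  show "finite {card {X. set X \<subseteq> P \<and> distance_config G w X} | P. finite P \<and> card P = n}"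
    by (rule config_counts_finite) (auto simp: distance_config_def)
qed (use exists_planar_point_set in auto)

lemma dot_config_counts:
  "finite {card {X. set X \<subseteq> P \<and> dot_config G w X} | P. finite P \<and> card P = n}"
  "{card {X. set X \<subseteq> P \<and> dot_config G w X} | P. finite P \<and> card P = n} \<noteq> {}"
proof -
  show "finite {card {X. set X \<subseteq> P \<and> dot_config G w X} | P. finite P \<and> card P = n}"
    by (rule config_counts_finite) (auto simp: dot_config_def)
qed (use exists_planar_point_set in auto)

end

theory Submission
  imports Defs
begin

text \<open>An embedding of \<open>G\<close> is determined by its restrictions to the paths of the cover, so it
  suffices that \<open>P\<^sub>2\<close> has \<open>O(n\<^sup>4\<^sup>/\<^sup>3)\<close> and \<open>P\<^sub>3\<close> has \<open>O(n\<^sup>2)\<close> embeddings. For \<open>P\<^sub>3\<close>, the two end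
  points leave at most two choices for the middle point (parallel end points in the dot product
  case aside). For \<open>P\<^sub>2\<close>, one counts incidences between \<open>n\<close> points and \<open>n\<close> upper semicircles of
  equal radius, or \<open>n\<close> non-vertical lines. Both are families of graphs of functions that
  pairwise meet at most once, to which Szekely's crossing argument applies. All arcs being
  \<open>x\<close>-monotone, the linear bound on the number of arcs in a crossing-free drawing follows from
  a charging argument instead of Euler's formula.\<close>

section \<open>Crossing-free systems of arcs\<close>

text \<open>An element \<open>(i, a, b)\<close> of \<open>E\<close> stands for the graph of
  \<open>F i\<close> over \<open>[a, b]\<close>, an edge of a plane drawing on the vertices
  \<open>S\<close>. \<open>noncross\<close> concerns abscissas interior to both arcs, so arcs may
  share end points; \<open>simple\<close> excludes double edges.\<close>

locale noncrossing_arcs =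
  fixes S :: "(real \<times> real) set" and F :: "'c \<Rightarrow> real \<Rightarrow> real" and E :: "('c \<times> real \<times> real) set"
  assumes finS: "finite S" and finE: "finite E"
    and arc: "\<And>i a b. (i, a, b) \<in> E \<Longrightarrow>
      a < b \<and> continuous_on {a..b} (F i) \<and> (a, F i a) \<in> S \<and> (b, F i b) \<in> S"
    and avoid: "\<And>i a b x. (i, a, b) \<in> E \<Longrightarrow> a < x \<Longrightarrow> x < b \<Longrightarrow> (x, F i x) \<notin> S"
    and noncross: "\<And>i a b j c d x. (i, a, b) \<in> E \<Longrightarrow> (j, c, d) \<in> E \<Longrightarrow> (i, a, b) \<noteq> (j, c, d) \<Longrightarrow>
      a < x \<Longrightarrow> x < b \<Longrightarrow> c < x \<Longrightarrow> x < d \<Longrightarrow> F i x \<noteq> F j x"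
    and simple: "\<And>i a b j. (i, a, b) \<in> E \<Longrightarrow> (j, a, b) \<in> E \<Longrightarrow> F i a = F j a \<Longrightarrow> F i b = F j b \<Longrightarrow> i = j"
begin

text \<open>A change of order would force, by the intermediate value theorem, a meeting at an
  abscissa other than \<open>x0\<close> and hence interior to both arcs. This is why
  \<open>x0\<close> itself may be an end point.\<close>

lemma order_const:
  assumes e: "(i, a, b) \<in> E" "(j, c, d) \<in> E"
    and x0: "a \<le> x0" "x0 \<le> b" "c \<le> x0" "x0 \<le> d" "F i x0 < F j x0"
    and x: "a < x" "x < b" "c < x" "x < d"
  shows "F i x < F j x"
proof (rule ccontr)
  assume neg: "\<not> F i x < F j x"
  have ne: "(i, a, b) \<noteq> (j, c, d)" using x0 by auto
  have cont: "continuous_on {l..u} (\<lambda>x. F j x - F i x)"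
    if "a \<le> l" "u \<le> b" "c \<le> l" "u \<le> d" for l u
    using arc[OF e(1)] arc[OF e(2)] that
    by (intro continuous_intros) (auto elim!: continuous_on_subset)
  consider "x = x0" | "x < x0" | "x0 < x" by linarith
  then obtain y where "a < y" "y < b" "c < y" "y < d" "F i y = F j y"
  proof cases
    case 1 then show ?thesis using neg x0 by simp
  next
    case 2
    obtain y where "x \<le> y" "y \<le> x0" "F j y - F i y = 0"
      using IVT'[of "\<lambda>x. F j x - F i x" x 0 x0] cont[of x x0] 2 x x0 neg by auto
    moreover from this have "y \<noteq> x0" using x0 by auto
    ultimately show ?thesis using x x0 that[of y] by auto
  next
    case 3
    obtain y where "x0 \<le> y" "y \<le> x" "F j y - F i y = 0"
      using IVT2'[of "\<lambda>x. F j x - F i x" x 0 x0] cont[of x0 x] 3 x x0 neg by auto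
    moreover from this have "y \<noteq> x0" using x0 by auto
    ultimately show ?thesis using x x0 that[of y] by auto
  qed
  then show False using noncross[OF e ne] by blast
qed

text \<open>Heights at this abscissa rank the arcs leaving a vertex, in place of their angular
  order. Since \<open>E\<close> is finite, one abscissa serves all arcs starting at
  \<open>a\<close>.\<close>

definition after :: "real \<Rightarrow> real" where
  "after a = (SOME x. a < x \<and> (\<forall>i b. (i, a, b) \<in> E \<longrightarrow> x < b))"

definition before :: "real \<Rightarrow> real" where
  "before b = (SOME x. x < b \<and> (\<forall>i a. (i, a, b) \<in> E \<longrightarrow> a < x))"

lemma after: "a < after a" "(i, a, b) \<in> E \<Longrightarrow> after a < b"
proof -
  let ?B = "(\<lambda>(i, a, b). b) ` {e \<in> E. fst (snd e) = a}"
  have "finite ?B" using finE by simp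
  have "\<exists>x>a. \<forall>b\<in>?B. x < b"
  proof (cases "?B = {}")
    case True then show ?thesis by (metis empty_iff gt_ex)
  next
    case False
    then have "a < Min ?B" using arc \<open>finite ?B\<close> by (auto simp: Min_gr_iff)
    then obtain x where "a < x" "x < Min ?B" using dense by blast
    then show ?thesis using Min_le[OF \<open>finite ?B\<close>] by (intro exI[of _ x]) fastforce
  qed
  then obtain x where "a < x" "\<And>b. b \<in> ?B \<Longrightarrow> x < b" by blast
  moreover have "b \<in> ?B" if "(i, a, b) \<in> E" for i b
    using that by (intro image_eqI[of _ _ "(i, a, b)"]) auto
  ultimately have "\<exists>x. a < x \<and> (\<forall>i b. (i, a, b) \<in> E \<longrightarrow> x < b)" by blast
  from someI_ex[OF this] show "a < after a" "(i, a, b) \<in> E \<Longrightarrow> after a < b"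
    unfolding after_def by blast+
qed

lemma before: "before b < b" "(i, a, b) \<in> E \<Longrightarrow> a < before b"
proof -
  let ?B = "(\<lambda>(i, a, b). a) ` {e \<in> E. snd (snd e) = b}"
  have "finite ?B" using finE by simp
  have "\<exists>x<b. \<forall>a\<in>?B. a < x"
  proof (cases "?B = {}")
    case True then show ?thesis by (metis empty_iff lt_ex)
  next
    case False
    then have "Max ?B < b" using arc \<open>finite ?B\<close> by (auto simp: Max_less_iff)
    then obtain x where "x < b" "Max ?B < x" using dense by blast
    then show ?thesis using Max_ge[OF \<open>finite ?B\<close>] by (intro exI[of _ x]) fastforce
  qed
  then obtain x where "x < b" "\<And>a. a \<in> ?B \<Longrightarrow> a < x" by blast
  moreover have "a \<in> ?B" if "(i, a, b) \<in> E" for i a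
    using that by (intro image_eqI[of _ _ "(i, a, b)"]) auto
  ultimately have "\<exists>x. x < b \<and> (\<forall>i a. (i, a, b) \<in> E \<longrightarrow> a < x)" by blast
  from someI_ex[OF this] show "before b < b" "(i, a, b) \<in> E \<Longrightarrow> a < before b"
    unfolding before_def by blast+
qed

text \<open>Arcs are charged to vertices in three ways: as highest arc leaving the left end, as
  highest arc arriving at the right end, or as first arc straight below a vertex. Each way charges a
  vertex at most once, whence the factor \<open>3\<close> in
  \<open>card_noncrossing\<close>.\<close>

definition top_left :: "('c \<times> real \<times> real) set" where
  "top_left = {(i, a, b). (i, a, b) \<in> E \<and>
     (\<forall>j d. (j, a, d) \<in> E \<longrightarrow> F j a = F i a \<longrightarrow> F j (after a) \<le> F i (after a))}"

definition top_right :: "('c \<times> real \<times> real) set" where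
  "top_right = {(i, a, b). (i, a, b) \<in> E \<and>
     (\<forall>j c. (j, c, b) \<in> E \<longrightarrow> F j b = F i b \<longrightarrow> F j (before b) \<le> F i (before b))}"

definition first_below :: "real \<times> real \<Rightarrow> 'c \<times> real \<times> real \<Rightarrow> bool" where
  "first_below q = (\<lambda>(i, a, b). (i, a, b) \<in> E \<and> a < fst q \<and> fst q < b \<and> F i (fst q) < snd q \<and>
     (\<forall>h c d. (h, c, d) \<in> E \<longrightarrow> c < fst q \<longrightarrow> fst q < d \<longrightarrow>
        F h (fst q) < snd q \<longrightarrow> F h (fst q) \<le> F i (fst q)))"

text \<open>Two such arcs have equal height at the abscissa of \<open>q\<close>, which is interior
  to both.\<close>

lemma first_below_unique:
  assumes "first_below q e" "first_below q e'"
  shows "e = e'"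
proof -
  obtain i a b j c d where e: "e = (i, a, b)" "e' = (j, c, d)" by (metis prod.collapse)
  have "F i (fst q) = F j (fst q)"
    using assms unfolding e first_below_def by (auto intro!: antisym)
  then show ?thesis
    using assms noncross[of i a b j c d "fst q"] unfolding e first_below_def by auto
qed

text \<open>Two highest arcs leaving the same vertex agree at \<open>after a\<close>, an abscissa
  interior to both, so they coincide.\<close>

lemma card_top_left: "card top_left \<le> card S"
proof (rule card_inj_on_le)
  show "inj_on (\<lambda>(i, a, b). (a, F i a)) top_left"
  proof (rule inj_onI, unfold split_paired_all prod.case prod.inject, elim conjE)
    fix i a b j c d
    assume e: "(i, a, b) \<in> top_left" "(j, c, d) \<in> top_left" and c: "a = c" and eq: "F i a = F j c"
    note e = e[folded c] and eq = eq[folded c]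
    from e have E: "(i, a, b) \<in> E" "(j, a, d) \<in> E" unfolding top_left_def by auto
    have "F i (after a) = F j (after a)"
      using e eq unfolding top_left_def by (auto intro!: antisym)
    then show "i = j \<and> a = c \<and> b = d"
      using c noncross[OF E, of "after a"] after(1)[of a] after(2)[OF E(1)] after(2)[OF E(2)] by blast
  qed
qed (use arc finS in \<open>auto simp: top_left_def\<close>)

lemma card_top_right: "card top_right \<le> card S"
proof (rule card_inj_on_le)
  show "inj_on (\<lambda>(i, a, b). (b, F i b)) top_right"
  proof (rule inj_onI, unfold split_paired_all prod.case prod.inject, elim conjE)
    fix i a b j c d
    assume e: "(i, a, b) \<in> top_right" "(j, c, d) \<in> top_right" and d: "b = d" and eq: "F i b = F j d"
    note e = e[folded d] and eq = eq[folded d]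
    from e have E: "(i, a, b) \<in> E" "(j, c, b) \<in> E" unfolding top_right_def by auto
    have "F i (before b) = F j (before b)"
      using e eq unfolding top_right_def by (auto intro!: antisym)
    then show "i = j \<and> a = c \<and> b = d"
      using d noncross[OF E, of "before b"] before(1)[of b] before(2)[OF E(1)] before(2)[OF E(2)]
      by blast
  qed
qed (use arc finS in \<open>auto simp: top_right_def\<close>)

lemma card_first_below: "card {e \<in> E. \<exists>q\<in>S. first_below q e} \<le> card S"
proof (rule surj_card_le[OF finS])
  show "{e \<in> E. \<exists>q\<in>S. first_below q e} \<subseteq> (\<lambda>q. THE e. first_below q e) ` S"
  proof (clarify)
    fix i a b x y
    assume "(x, y) \<in> S" "first_below (x, y) (i, a, b)"
    moreover have "(THE e. first_below (x, y) e) = (i, a, b)"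
      using calculation first_below_unique by (intro the_equality) auto
    ultimately show "(i, a, b) \<in> (\<lambda>q. THE e. first_below q e) ` S"
      by (metis image_eqI)
  qed
qed

text \<open>If an arc is not topmost at its left end, consider the closed wedge between it and the next
  higher arc with the same left end, up to the nearer right end. The leftmost vertex of this wedge
  (the lowest one, in case of ties) either sees the arc directly below it, or is the right end of
  the arc, which is then topmost there.\<close>

lemma edge_trichotomy:
  assumes e: "(i, a, b) \<in> E" and not_left: "(i, a, b) \<notin> top_left"
  shows "(i, a, b) \<in> top_right \<or> (\<exists>q\<in>S. first_below q (i, a, b))"
proof -
  let ?s = "after a"
  \<comment> \<open>These arcs leave the same vertex above the given arc. The lowest of them,
    \<open>j\<close>, bounds the wedge from above.\<close>
  define N where "N = {(j, d). (j, a, d) \<in> E \<and> F j a = F i a \<and> F i ?s < F j ?s}"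
  have "N \<subseteq> (\<lambda>(i, a, b). (i, b)) ` E" unfolding N_def by force
  then have finN: "finite N" using finE finite_subset by blast
  have neN: "N \<noteq> {}" using e not_left unfolding N_def top_left_def by (auto simp: not_le)
  obtain j d where jd: "(j, d) \<in> N"
    and least: "\<And>h d'. (h, d') \<in> N \<Longrightarrow> F j ?s \<le> F h ?s"
    using ex_is_arg_min_if_finite[OF finN neN, of "\<lambda>(j, d). F j ?s"]
    unfolding is_arg_min_linorder by (auto split: prod.splits)
  from jd have e': "(j, a, d) \<in> E" "F j a = F i a" and ij: "F i ?s < F j ?s"
    unfolding N_def by auto
  have s: "a < ?s" "?s < b" "?s < d" using after e e' by blast+
  define m where "m = min b d"
  have am: "a < m" using s by (auto simp: m_def)
  have below: "F i x < F j x" if "a < x" "x < m" for x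
    using order_const[OF e e'(1) _ _ _ _ ij] s that by (auto simp: m_def)
  have below_eq: "F i x \<le> F j x" if "a \<le> x" "x \<le> m" for x
  proof (rule ccontr)
    assume "\<not> ?thesis"
    then have "F j ?s < F i ?s"
      using order_const[OF e'(1) e, of x ?s] that s by (auto simp: m_def)
    then show False using ij by simp
  qed
  define W where "W = {q \<in> S. a < fst q \<and> fst q \<le> m \<and> F i (fst q) \<le> snd q \<and> snd q \<le> F j (fst q)}"
  have finW: "finite W" using finS unfolding W_def by simp
  \<comment> \<open>The nearer of the two right ends belongs to the wedge.\<close>
  have neW: "W \<noteq> {}"
  proof (cases "b \<le> d")
    case True
    then have "(b, F i b) \<in> W" using arc[OF e] below_eq[of b] by (auto simp: W_def m_def)
    then show ?thesis by auto
  next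
    case False
    then have "(d, F j d) \<in> W" using arc[OF e'(1)] below_eq[of d] by (auto simp: W_def m_def)
    then show ?thesis by auto
  qed
  define x0 where "x0 = Min (fst ` W)"
  have x0_in: "x0 \<in> fst ` W" and x0_min: "\<And>q. q \<in> W \<Longrightarrow> x0 \<le> fst q"
    unfolding x0_def using finW neW by auto
  define Y where "Y = snd ` {q \<in> W. fst q = x0}"
  define y0 where "y0 = Min Y"
  have "finite Y" "Y \<noteq> {}" using finW x0_in unfolding Y_def by auto
  then have "y0 \<in> Y" and y0_min: "\<And>y. y \<in> Y \<Longrightarrow> y0 \<le> y" unfolding y0_def by auto
  then have q0: "(x0, y0) \<in> W" unfolding Y_def by auto
  then have q0S: "(x0, y0) \<in> S" and x0: "a < x0" "x0 \<le> b" "x0 \<le> d" "x0 \<le> m"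
    and y0: "F i x0 \<le> y0" "y0 \<le> F j x0"
    unfolding W_def m_def by auto
  \<comment> \<open>An arc passing between the two arcs just left of \<open>x0\<close> would have to enter the wedge
    through a vertex further left.\<close>
  have key: False
    if h: "(h, c, d') \<in> E" "c < x0" "x0 \<le> d'"
      and btw: "\<And>x. a < x \<Longrightarrow> c < x \<Longrightarrow> x < x0 \<Longrightarrow> F i x < F h x \<and> F h x < F j x" for h c d'
  proof -
    obtain x where x: "max a c < x" "x < x0" using dense[of "max a c" x0] h x0 by auto
    have bx: "F i x < F h x" "F h x < F j x" using btw x by auto
    have btw_eq: "F i y \<le> F h y \<and> F h y \<le> F j y" if y: "a \<le> y" "c \<le> y" "y < x0" for y
    proof (rule ccontr)
      assume "\<not> ?thesis"
      then consider "F h y < F i y" | "F j y < F h y" by linarith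
      then show False
      proof cases
        case 1
        then show False
          using order_const[OF h(1) e, of y x] x x0 h y bx by auto
      next
        case 2
        then show False
          using order_const[OF e'(1) h(1), of y x] x x0 h y bx by auto
      qed
    qed
    \<comment> \<open>If \<open>h\<close> starts right of \<open>a\<close>, its left end is a vertex
      of the wedge left of \<open>x0\<close>. If it starts left of \<open>a\<close>, it runs through
      the common left end of \<open>i\<close> and \<open>j\<close>. If it starts at
      \<open>a\<close>, it leaves that same vertex between \<open>i\<close> and \<open>j\<close>,
      against the choice of \<open>j\<close>.\<close>
    consider "a < c" | "c < a" | "c = a" by linarith
    then show False
    proof cases
      case 1
      then have "(c, F h c) \<in> W"
        using btw_eq[of c] arc[OF h(1)] h x0 unfolding W_def by auto
      then show False using x0_min[of "(c, F h c)"] h by auto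
    next
      case 2
      then have "F h a = F i a" using btw_eq[of a] x0 e' by auto
      then show False using avoid[OF h(1), of a] arc[OF e] 2 x0 h by auto
    next
      case 3
      have ha: "(h, a, d') \<in> E" "?s < d'" using h 3 after by blast+
      have "F h a = F i a" using btw_eq[of a] x0 e' 3 by auto
      moreover have "F i ?s < F h ?s"
        using order_const[OF e h(1), of x ?s] x x0 h bx s ha 3 by auto
      ultimately have "(h, d') \<in> N" using ha unfolding N_def by auto
      moreover have "F h ?s < F j ?s"
        using order_const[OF h(1) e'(1), of x ?s] x x0 h bx s ha 3 by auto
      ultimately show False using least by force
    qed
  qed
  show ?thesis
  proof (cases "y0 = F i x0")
    case True
    then have "(x0, F i x0) \<in> S" using q0S by simp
    then have "\<not> x0 < b" using avoid[OF e, of x0] x0(1) by blast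
    then have x0b: "x0 = b" using x0 by linarith
    \<comment> \<open>With equal heights, \<open>j\<close> would either end at the same vertex,
      giving a double edge, or run through it.\<close>
    have "F i b \<noteq> F j b"
    proof
      assume eq: "F i b = F j b"
      show False
      proof (cases "d = b")
        case True
        then have "i = j" using simple[OF e] e' eq by auto
        then show False using ij by simp
      next
        case False
        then show False using avoid[OF e'(1), of b] arc[OF e] eq x0 x0b by auto
      qed
    qed
    then have ltb: "F i b < F j b" using y0 True x0b by auto
    \<comment> \<open>A higher arc arriving at the same right end would lie inside the wedge just
      left of \<open>x0\<close>, which \<open>key\<close> excludes.\<close>
    have "(i, a, b) \<in> top_right"
    proof (rule ccontr)
      assume "(i, a, b) \<notin> top_right"
      then obtain h c where h: "(h, c, b) \<in> E" "F h b = F i b" "F i (before b) < F h (before b)"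
        using e unfolding top_right_def by (auto simp: not_le)
      have bb: "before b < b" "a < before b" "c < before b" using before e h(1) by blast+
      show False
      proof (rule key[OF h(1)])
        show "c < x0" "x0 \<le> b" using bb x0b by auto
        fix x assume x: "a < x" "c < x" "x < x0"
        have "F i x < F h x" using order_const[OF e h(1), of "before b" x] x bb h x0b by auto
        moreover have "F h x < F j x"
          using order_const[OF h(1) e'(1), of b x] x bb h x0b x0 ltb by auto
        ultimately show "F i x < F h x \<and> F h x < F j x" ..
      qed
    qed
    then show ?thesis ..
  next
    case False
    then have lt: "F i x0 < y0" using y0 by simp
    \<comment> \<open>Otherwise the right end of the arc would be a lower vertex of the wedge on the
      same vertical; here the tie-breaking rule matters.\<close>
    have "x0 \<noteq> b"
    proof
      assume "x0 = b"
      then have "(b, F i b) \<in> W" using arc[OF e] y0 x0 unfolding W_def by auto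
      then have "F i b \<in> Y" using \<open>x0 = b\<close> unfolding Y_def by force
      then show False using y0_min lt \<open>x0 = b\<close> by force
    qed
    then have x0b: "x0 < b" using x0 by simp
    \<comment> \<open>An arc separating the vertex from the given arc would, followed to the left,
      lie inside the wedge, which \<open>key\<close> excludes.\<close>
    have "first_below (x0, y0) (i, a, b)"
      unfolding first_below_def
    proof (clarsimp simp: e x0 x0b lt, rule ccontr)
      fix h c d'
      assume h: "(h, c, d') \<in> E" "c < x0" "x0 < d'" "F h x0 < y0" "\<not> F h x0 \<le> F i x0"
      show False
      proof (rule key[OF h(1)])
        show "c < x0" "x0 \<le> d'" using h by auto
        fix x assume x: "a < x" "c < x" "x < x0"
        have "F i x < F h x" using order_const[OF e h(1), of x0 x] x h x0 by auto
        moreover have "F h x < F j x"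
          using order_const[OF h(1) e'(1), of x0 x] x h x0 y0 by auto
        ultimately show "F i x < F h x \<and> F h x < F j x" ..
      qed
    qed
    then show ?thesis using q0S by blast
  qed
qed

theorem card_noncrossing: "card E \<le> 3 * card S"
proof -
  let ?B = "{e \<in> E. \<exists>q\<in>S. first_below q e}"
  have sub: "top_left \<subseteq> E" "top_right \<subseteq> E" unfolding top_left_def top_right_def by auto
  have "E \<subseteq> top_left \<union> top_right \<union> ?B"
    using edge_trichotomy by auto
  then have "card E \<le> card (top_left \<union> top_right \<union> ?B)"
    using finE sub by (intro card_mono) (auto intro: finite_subset)
  also have "\<dots> \<le> card top_left + card top_right + card ?B"
    by (meson add_le_mono1 card_Un_le order_trans)
  finally show ?thesis
    using card_top_left card_top_right card_first_below by linarith
qed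

end

section \<open>Incidences with curves meeting at most once\<close>

text \<open>Each point outside \<open>T\<close> keeps \<open>k\<close> free choices. Divided by the
  number of all colourings, this says that \<open>T\<close> is entirely of colour \<open>0\<close>
  with probability \<open>1 / k ^ card T\<close>.\<close>

lemma card_colourings_vanishing:
  assumes P: "finite P" and T: "T \<subseteq> P" and k: "k \<ge> (1::nat)"
  shows "real (card {c \<in> P \<rightarrow>\<^sub>E {..<k}. \<forall>p\<in>T. c p = 0}) = real k ^ card P / real k ^ card T"
proof -
  let ?D = "\<lambda>p. if p \<in> T then {0} else {..<k}"
  have "{c \<in> P \<rightarrow>\<^sub>E {..<k}. \<forall>p\<in>T. c p = 0} = Pi\<^sub>E P ?D" (is "?L = ?R")
  proof (rule set_eqI)
    fix c
    show "c \<in> ?L \<longleftrightarrow> c \<in> ?R"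
      using T k unfolding PiE_iff by (auto split: if_splits)
  qed
  also have "card \<dots> = (\<Prod>p\<in>P. card (?D p))" by (rule card_PiE[OF P])
  also have "\<dots> = (\<Prod>p\<in>P. if p \<in> T then 1 else k)" by (rule prod.cong) auto
  also have "\<dots> = k ^ card (P - T)"
    using P by (simp add: prod.If_cases Diff_eq)
  finally have "card ?L = k ^ (card P - card T)"
    using P T by (simp add: card_Diff_subset finite_subset)
  moreover have "card T \<le> card P" using P T by (rule card_mono)
  ultimately have "card ?L * k ^ card T = k ^ card P" by (simp flip: power_add)
  then have "real (card ?L) * real k ^ card T = real k ^ card P"
    by (simp only: of_nat_mult[symmetric] of_nat_power[symmetric])
  then show ?thesis using k by (simp add: eq_divide_eq)
qed

text \<open>Double counting; with colourings as one index set it is linearity of expectation,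
  unnormalised.\<close>

lemma sum_card_Collect_swap:
  assumes "finite A" "finite B"
  shows "(\<Sum>a\<in>A. real (card {b \<in> B. R a b})) = (\<Sum>b\<in>B. real (card {a \<in> A. R a b}))"
proof -
  have "(\<Sum>a\<in>A. real (card {b \<in> B. R a b})) = (\<Sum>a\<in>A. \<Sum>b\<in>B. of_bool (R a b))"
    using assms by (simp add: of_bool_def Int_def sum.If_cases)
  also have "\<dots> = (\<Sum>b\<in>B. \<Sum>a\<in>A. of_bool (R a b))" by (rule sum.swap)
  also have "\<dots> = (\<Sum>b\<in>B. real (card {a \<in> A. R a b}))"
    using assms by (simp add: of_bool_def Int_def sum.If_cases)
  finally show ?thesis .
qed

text \<open>The domains \<open>D i\<close> admit bounded arcs as well as whole lines. Their
  convexity ensures that a curve is defined all the way between two of its points.\<close>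

locale curve_arrangement =
  fixes C :: "'c set" and D :: "'c \<Rightarrow> real set" and F :: "'c \<Rightarrow> real \<Rightarrow> real"
    and P :: "(real \<times> real) set"
  assumes finC: "finite C" and finP: "finite P"
    and conv: "\<And>i. i \<in> C \<Longrightarrow> convex (D i)"
    and cont: "\<And>i. i \<in> C \<Longrightarrow> continuous_on (D i) (F i)"
    and meet: "\<And>i j x y. i \<in> C \<Longrightarrow> j \<in> C \<Longrightarrow> i \<noteq> j \<Longrightarrow> x \<in> D i \<inter> D j \<Longrightarrow> y \<in> D i \<inter> D j \<Longrightarrow>
      F i x = F j x \<Longrightarrow> F i y = F j y \<Longrightarrow> x = y"
begin

text \<open>A point on the graph of \<open>F i\<close> is determined by its abscissa, so the
  abscissa alone is recorded.\<close>

definition incidences :: "('c \<times> real) set" where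
  "incidences = {(i, x). i \<in> C \<and> x \<in> D i \<and> (x, F i x) \<in> P}"

text \<open>These are the edges of Szekely's drawing: the pieces of a curve between consecutive
  points of \<open>P\<close>.\<close>

definition segments :: "('c \<times> real \<times> real) set" where
  "segments = {(i, a, b). (i, a) \<in> incidences \<and> (i, b) \<in> incidences \<and> a < b \<and>
     (\<forall>x. a < x \<longrightarrow> x < b \<longrightarrow> (x, F i x) \<notin> P)}"

definition crossing :: "('c \<times> real \<times> real) \<Rightarrow> ('c \<times> real \<times> real) \<Rightarrow> bool" where
  "crossing = (\<lambda>(i, a, b) (j, c, d). (i, a, b) \<noteq> (j, c, d) \<and>
     (\<exists>x. a < x \<and> x < b \<and> c < x \<and> x < d \<and> F i x = F j x))"

definition ends :: "('c \<times> real \<times> real) \<Rightarrow> (real \<times> real) set" where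
  "ends = (\<lambda>(i, a, b). {(a, F i a), (b, F i b)})"

text \<open>Pairs are ordered, so each crossing is counted twice; this affects only
  constants.\<close>

definition crossings :: "(('c \<times> real \<times> real) \<times> ('c \<times> real \<times> real)) set" where
  "crossings = {(e, e'). e \<in> segments \<and> e' \<in> segments \<and> crossing e e'}"

section \<open>Segments, their ends and their crossings\<close>

lemma finite_incidences: "finite incidences"
proof (rule finite_subset)
  show "incidences \<subseteq> C \<times> fst ` P" unfolding incidences_def by force
qed (use finC finP in simp)

lemma finite_segments: "finite segments"
proof (rule finite_subset)
  show "segments \<subseteq> (\<lambda>((i, a), (j, b)). (i, a, b)) ` (incidences \<times> incidences)"
    unfolding segments_def by force
qed (use finite_incidences in simp)

lemma segment_domain:
  assumes "(i, a, b) \<in> segments" "a \<le> x" "x \<le> b"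
  shows "x \<in> D i"
proof -
  have "{a..b} \<subseteq> D i"
    using assms conv[of i] unfolding segments_def incidences_def
    by (auto simp: is_interval_convex_1[symmetric] intro: mem_is_interval_1_I)
  then show ?thesis using assms by auto
qed

text \<open>If two overlapping pieces of one curve differed, an end of one would lie in the interior
  of the other.\<close>

lemma segments_same_curve:
  assumes "(i, a, b) \<in> segments" "(i, c, d) \<in> segments" "a < x" "x < b" "c < x" "x < d"
  shows "a = c \<and> b = d"
proof -
  have P: "(a, F i a) \<in> P" "(b, F i b) \<in> P" "(c, F i c) \<in> P" "(d, F i d) \<in> P"
    and n: "\<And>x. a < x \<Longrightarrow> x < b \<Longrightarrow> (x, F i x) \<notin> P" "\<And>x. c < x \<Longrightarrow> x < d \<Longrightarrow> (x, F i x) \<notin> P"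
    using assms unfolding segments_def incidences_def by auto
  show ?thesis
    using n(1)[of c] n(1)[of d] n(2)[of a] n(2)[of b] P assms by linarith
qed

lemma crossing_distinct_curves:
  assumes "(i, a, b) \<in> segments" "(j, c, d) \<in> segments" "crossing (i, a, b) (j, c, d)"
  shows "i \<noteq> j"
  using assms segments_same_curve[of i a b c d] unfolding crossing_def by auto

text \<open>An ordered pair of distinct curves has at most one meeting point, and this point is
  interior to at most one segment of each curve. Hence a crossing is determined by its two
  curves.\<close>

lemma card_crossings: "card crossings \<le> (card C)\<^sup>2"
proof -
  have "card crossings \<le> card (C \<times> C)"
  proof (rule card_inj_on_le)
    show "inj_on (\<lambda>(e, e'). (fst e, fst e')) crossings"
    proof (rule inj_onI, unfold split_paired_all prod.case prod.inject fst_conv, elim conjE)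
      fix i a b j c d i' a' b' j' c' d'
      assume X: "((i, a, b), j, c, d) \<in> crossings" "((i', a', b'), j', c', d') \<in> crossings"
        and eq: "i = i'" "j = j'"
      have E: "(i, a, b) \<in> segments" "(j, c, d) \<in> segments"
        "(i, a', b') \<in> segments" "(j, c', d') \<in> segments"
        using X eq unfolding crossings_def by auto
      have "i \<noteq> j"
        using X crossing_distinct_curves[OF E(1,2)] unfolding crossings_def by simp
      obtain x where x: "a < x" "x < b" "c < x" "x < d" "F i x = F j x"
        using X unfolding crossings_def crossing_def by auto
      obtain y where y: "a' < y" "y < b'" "c' < y" "y < d'" "F i y = F j y"
        using X eq unfolding crossings_def crossing_def by auto
      have "x \<in> D i \<inter> D j"
        using segment_domain[OF E(1), of x] segment_domain[OF E(2), of x] x by simp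
      moreover have "y \<in> D i \<inter> D j"
        using segment_domain[OF E(3), of y] segment_domain[OF E(4), of y] y by simp
      moreover have "i \<in> C" "j \<in> C" using E unfolding segments_def incidences_def by auto
      ultimately have "x = y" using meet \<open>i \<noteq> j\<close> x(5) y(5) by blast
      then show "(i = i' \<and> a = a' \<and> b = b') \<and> j = j' \<and> c = c' \<and> d = d'"
        using segments_same_curve[OF E(1,3), of x] segments_same_curve[OF E(2,4), of x] x y eq
        by simp
    qed
    show "(\<lambda>(e, e'). (fst e, fst e')) ` crossings \<subseteq> C \<times> C"
      unfolding crossings_def segments_def incidences_def by auto
  qed (use finC in simp)
  then show ?thesis by (simp add: card_cartesian_product power2_eq_square)
qed

lemma card_ends:
  assumes "e \<in> segments"
  shows "card (ends e) = 2" "ends e \<subseteq> P"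
  using assms unfolding segments_def incidences_def ends_def by auto

text \<open>A common end would be a second meeting point of the two curves. The four distinct ends
  are what makes a crossing survive sampling only with probability \<open>1 / k ^ 4\<close>.\<close>

lemma card_ends_crossing:
  assumes "(e, e') \<in> crossings"
  shows "card (ends e \<union> ends e') = 4"
proof -
  obtain i a b j c d where e: "e = (i, a, b)" "e' = (j, c, d)" by (metis prod.collapse)
  have E: "(i, a, b) \<in> segments" "(j, c, d) \<in> segments" and X: "crossing (i, a, b) (j, c, d)"
    using assms unfolding e crossings_def by auto
  have ij: "i \<noteq> j" using crossing_distinct_curves[OF E X] .
  obtain x where x: "a < x" "x < b" "c < x" "x < d" "F i x = F j x"
    using X unfolding crossing_def by auto
  have C: "i \<in> C" "j \<in> C" using E unfolding segments_def incidences_def by auto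
  have xD: "x \<in> D i \<inter> D j"
    using segment_domain[OF E(1), of x] segment_domain[OF E(2), of x] x by simp
  have "ends e \<inter> ends e' = {}"
  proof (rule ccontr)
    assume "ends e \<inter> ends e' \<noteq> {}"
    then obtain p where "p \<in> ends e" "p \<in> ends e'" by auto
    then have y: "fst p = a \<or> fst p = b" "fst p = c \<or> fst p = d" "F i (fst p) = F j (fst p)"
      unfolding e ends_def by auto
    have "fst p \<in> D i \<inter> D j"
      using segment_domain[OF E(1), of "fst p"] segment_domain[OF E(2), of "fst p"] x y by auto
    then have "x = fst p" using meet[OF C ij xD _ x(5)] y by blast
    then show False using x y by auto
  qed
  then show ?thesis
    using card_ends[of e] card_ends[of e'] E finP finite_subset
    by (subst card_Un_disjoint) (auto simp: e)
qed

text \<open>Deletion argument: discarding every surviving segment that takes part in a surviving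
  crossing leaves a crossing-free system on \<open>S\<close>, and at most one segment is discarded
  per ordered crossing pair.\<close>

lemma card_segments_sample:
  assumes S: "S \<subseteq> P"
  shows "card {e \<in> segments. ends e \<subseteq> S} \<le>
    3 * card S + card {x \<in> crossings. ends (fst x) \<union> ends (snd x) \<subseteq> S}"
proof -
  let ?E = "{e \<in> segments. ends e \<subseteq> S}"
  let ?X = "{x \<in> crossings. ends (fst x) \<union> ends (snd x) \<subseteq> S}"
  have finX: "finite ?X"
  proof (rule finite_subset)
    show "?X \<subseteq> segments \<times> segments" unfolding crossings_def by auto
  qed (use finite_segments in simp)
  interpret noncrossing_arcs S F "?E - fst ` ?X"
  proof
    show "finite S" using S finP finite_subset by blast
    show "finite (?E - fst ` ?X)" using finite_segments by simp
    fix i a b assume e: "(i, a, b) \<in> ?E - fst ` ?X"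
    then have eS: "(i, a, b) \<in> segments" by simp
    have "continuous_on {a..b} (F i)"
    proof (rule continuous_on_subset)
      show "continuous_on (D i) (F i)" using cont eS unfolding segments_def incidences_def by auto
    qed (use segment_domain[OF eS] in auto)
    then show "a < b \<and> continuous_on {a..b} (F i) \<and> (a, F i a) \<in> S \<and> (b, F i b) \<in> S"
      using e unfolding segments_def ends_def by auto
    show "(x, F i x) \<notin> S" if "a < x" "x < b" for x
      using eS that S unfolding segments_def by auto
    show "F i x \<noteq> F j x" if e': "(j, c, d) \<in> ?E - fst ` ?X" and ne: "(i, a, b) \<noteq> (j, c, d)"
      and x: "a < x" "x < b" "c < x" "x < d" for j c d x
    proof
      assume "F i x = F j x"
      then have "((i, a, b), j, c, d) \<in> ?X"
        using e e' ne x unfolding crossings_def crossing_def by auto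
      then have "(i, a, b) \<in> fst ` ?X" by (rule image_eqI[rotated]) simp
      then show False using e by blast
    qed
    \<comment> \<open>A double edge would make two distinct curves meet at both \<open>a\<close> and
      \<open>b\<close>.\<close>
    show "i = j" if e': "(j, a, b) \<in> ?E - fst ` ?X" and eq: "F i a = F j a" "F i b = F j b" for j
    proof (rule ccontr)
      assume ij: "i \<noteq> j"
      have "a \<in> D i \<inter> D j" "b \<in> D i \<inter> D j" "i \<in> C" "j \<in> C" "a < b"
        using eS e' unfolding segments_def incidences_def by auto
      then show False using meet[of i j a b] ij eq by auto
    qed
  qed
  have "card ?E \<le> card ((?E - fst ` ?X) \<union> fst ` ?X)"
    using finite_segments finX by (intro card_mono) auto
  also have "\<dots> \<le> card (?E - fst ` ?X) + card (fst ` ?X)" by (rule card_Un_le)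
  also have "\<dots> \<le> 3 * card S + card ?X"
    using card_noncrossing card_image_le[OF finX] by (intro add_mono) auto
  finally show ?thesis .
qed

text \<open>Average the previous bound over all colourings of \<open>P\<close> with \<open>k\<close> colours, sampling the
  points of colour \<open>0\<close>; a segment survives with probability \<open>1/k\<^sup>2\<close>, a crossing with
  probability \<open>1/k\<^sup>4\<close>.\<close>

lemma card_segments:
  assumes k: "k \<ge> (1::nat)"
  shows "real (card segments) \<le> 3 * real k * real (card P) + (real (card C))\<^sup>2 / (real k)\<^sup>2"
proof -
  let ?K = "P \<rightarrow>\<^sub>E {..<k}"
  let ?S = "\<lambda>c. {p \<in> P. c p = 0}"
  let ?n = "real k ^ card P"
  have finK: "finite ?K" using finP by (simp add: finite_PiE)
  have finX: "finite crossings"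
  proof (rule finite_subset)
    show "crossings \<subseteq> segments \<times> segments" unfolding crossings_def by auto
  qed (use finite_segments in simp)
  have sub: "T \<subseteq> ?S c \<longleftrightarrow> (\<forall>p\<in>T. c p = 0)" if "T \<subseteq> P" for T c using that by auto
  have "(\<Sum>c\<in>?K. real (card {e \<in> segments. ends e \<subseteq> ?S c})) =
      (\<Sum>e\<in>segments. real (card {c \<in> ?K. ends e \<subseteq> ?S c}))"
    by (rule sum_card_Collect_swap[OF finK finite_segments])
  also have "\<dots> = (\<Sum>e\<in>segments. ?n / real k ^ 2)"
  proof (rule sum.cong[OF refl])
    fix e assume "e \<in> segments"
    note e = card_ends[OF this]
    show "real (card {c \<in> ?K. ends e \<subseteq> ?S c}) = ?n / real k ^ 2"
      unfolding sub[OF e(2)] card_colourings_vanishing[OF finP e(2) k] e(1) ..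
  qed
  finally have seg: "(\<Sum>c\<in>?K. real (card {e \<in> segments. ends e \<subseteq> ?S c})) =
      real (card segments) * (?n / real k ^ 2)" by simp
  have "(\<Sum>c\<in>?K. real (card (?S c))) = (\<Sum>p\<in>P. real (card {c \<in> ?K. c p = 0}))"
    by (rule sum_card_Collect_swap[OF finK finP])
  also have "\<dots> = (\<Sum>p\<in>P. ?n / real k)"
  proof (rule sum.cong[OF refl])
    fix p assume "p \<in> P"
    then show "real (card {c \<in> ?K. c p = 0}) = ?n / real k"
      using card_colourings_vanishing[OF finP, of "{p}" k] k by simp
  qed
  finally have pts: "(\<Sum>c\<in>?K. real (card (?S c))) = real (card P) * (?n / real k)" by simp
  have "(\<Sum>c\<in>?K. real (card {x \<in> crossings. ends (fst x) \<union> ends (snd x) \<subseteq> ?S c})) =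
      (\<Sum>x\<in>crossings. real (card {c \<in> ?K. ends (fst x) \<union> ends (snd x) \<subseteq> ?S c}))"
    by (rule sum_card_Collect_swap[OF finK finX])
  also have "\<dots> = (\<Sum>x\<in>crossings. ?n / real k ^ 4)"
  proof (rule sum.cong[OF refl])
    fix x assume x: "x \<in> crossings"
    then have s: "ends (fst x) \<union> ends (snd x) \<subseteq> P"
      using card_ends(2)[of "fst x"] card_ends(2)[of "snd x"] unfolding crossings_def by auto
    have c: "card (ends (fst x) \<union> ends (snd x)) = 4"
      using card_ends_crossing[of "fst x" "snd x"] x by simp
    show "real (card {c \<in> ?K. ends (fst x) \<union> ends (snd x) \<subseteq> ?S c}) = ?n / real k ^ 4"
      unfolding sub[OF s] card_colourings_vanishing[OF finP s k] c ..
  qed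
  finally have crs: "(\<Sum>c\<in>?K. real (card {x \<in> crossings. ends (fst x) \<union> ends (snd x) \<subseteq> ?S c})) =
      real (card crossings) * (?n / real k ^ 4)" by simp
  have "(\<Sum>c\<in>?K. real (card {e \<in> segments. ends e \<subseteq> ?S c})) \<le>
    (\<Sum>c\<in>?K. 3 * real (card (?S c)) +
      real (card {x \<in> crossings. ends (fst x) \<union> ends (snd x) \<subseteq> ?S c}))"
  proof (rule sum_mono)
    fix c
    have "?S c \<subseteq> P" by auto
    from of_nat_mono[OF card_segments_sample[OF this], where 'a = real]
    show "real (card {e \<in> segments. ends e \<subseteq> ?S c}) \<le> 3 * real (card (?S c)) +
      real (card {x \<in> crossings. ends (fst x) \<union> ends (snd x) \<subseteq> ?S c})" by simp
  qed
  also have "\<dots> = 3 * (real (card P) * (?n / real k)) + real (card crossings) * (?n / real k ^ 4)"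
    by (simp only: sum.distrib sum_distrib_left[symmetric] pts crs)
  finally have "real (card segments) * (?n / real k ^ 2) \<le>
    3 * (real (card P) * (?n / real k)) + real (card crossings) * (?n / real k ^ 4)"
    unfolding seg .
  \<comment> \<open>The factor \<open>k ^ card P / k ^ 2\<close> common to all terms is split off so
    that it can be cancelled.\<close>
  also have "\<dots> = (3 * real k * real (card P) + real (card crossings) / real k ^ 2) * (?n / real k ^ 2)"
    using k by (simp add: field_simps power2_eq_square power4_eq_xxxx)
  finally have "real (card segments) \<le> 3 * real k * real (card P) + real (card crossings) / real k ^ 2"
    by (rule mult_right_le_imp_le) (use k in simp)
  moreover have "real (card crossings) \<le> (real (card C))\<^sup>2"
    using of_nat_mono[OF card_crossings, where 'a = real] by simp
  ultimately show ?thesis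
    using divide_right_mono[of "real (card crossings)" "(real (card C))\<^sup>2" "real k ^ 2"] by simp
qed

text \<open>On each curve, every incidence except the leftmost is the right end of a
  segment.\<close>

lemma card_incidences_le_segments: "card incidences \<le> card C + card segments"
proof -
  let ?X = "\<lambda>i. {x. (i, x) \<in> incidences}"
  let ?M = "(\<lambda>i. (i, Min (?X i))) ` C"
  let ?R = "(\<lambda>(i, a, b). (i, b)) ` segments"
  have finX: "finite (?X i)" for i
    using finite_imageI[OF finite_incidences, of snd]
    by (rule rev_finite_subset) (auto intro: rev_image_eqI)
  have "incidences \<subseteq> ?M \<union> ?R"
  proof clarify
    fix i x assume ix: "(i, x) \<in> incidences" and "(i, x) \<notin> ?R"
    then have nR: "(i, a, x) \<notin> segments" for a by force
    have iC: "i \<in> C" using ix unfolding incidences_def by auto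
    have "Min (?X i) = x"
    proof (rule ccontr)
      let ?L = "{y \<in> ?X i. y < x}"
      assume "Min (?X i) \<noteq> x"
      moreover have "Min (?X i) \<le> x" using ix finX by simp
      moreover have "Min (?X i) \<in> ?X i" using ix finX by (intro Min_in) auto
      ultimately have "?L \<noteq> {}" by (auto simp: order_less_le)
      moreover have "finite ?L" using finX by simp
      ultimately have a: "Max ?L \<in> ?L" and max: "\<And>y. y \<in> ?L \<Longrightarrow> y \<le> Max ?L"
        using Max_in Max_ge by blast+
      \<comment> \<open>The predecessor of \<open>x\<close> among the incidences on the curve
        \<open>i\<close>.\<close>
      let ?a = "Max ?L"
      have "(i, ?a, x) \<in> segments"
        unfolding segments_def
      proof (clarify, intro conjI allI impI)
        show "(i, ?a) \<in> incidences" "(i, x) \<in> incidences" "?a < x" using a ix by auto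
        fix y assume y: "?a < y" "y < x"
        have "convex (D i)" using conv iC .
        moreover have "?a \<in> D i" "x \<in> D i" using a ix unfolding incidences_def by auto
        ultimately have "y \<in> D i"
          using y by (metis is_interval_convex_1 less_imp_le mem_is_interval_1_I)
        then show "(y, F i y) \<notin> P"
          using max[of y] y iC unfolding incidences_def by auto
      qed
      then show False using nR by blast
    qed
    then show "(i, x) \<in> ?M" using iC by force
  qed
  then have "card incidences \<le> card (?M \<union> ?R)"
    using finC finite_segments by (intro card_mono) auto
  also have "\<dots> \<le> card ?M + card ?R" by (rule card_Un_le)
  also have "\<dots> \<le> card C + card segments"
    using finC finite_segments by (intro add_mono card_image_le)
  finally show ?thesis .
qed

text \<open>The balanced case of the Szemeredi-Trotter bound. The constant is
  \<open>8 = 6 + 1 + 1\<close>, from the vertex term, the crossing term and the leftmost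
  incidences.\<close>

theorem card_incidences:
  assumes n: "card C \<le> n" "card P \<le> n" and pos: "n \<ge> 1"
  shows "real (card incidences) \<le> 8 * real n powr (4/3)"
proof -
  let ?r = "real n powr (1/3)"
  \<comment> \<open>This choice balances \<open>k * n\<close> against
    \<open>n\<^sup>2 / k\<^sup>2\<close>. Rounding up at most doubles the value because
    \<open>n powr (1/3)\<close> is at least \<open>1\<close>.\<close>
  define k where "k = nat \<lceil>?r\<rceil>"
  have r1: "1 \<le> ?r" using pos by (simp add: ge_one_powr_ge_zero)
  have k: "?r \<le> real k" "real k \<le> 2 * ?r" and k1: "k \<ge> 1"
    using r1 unfolding k_def by linarith+
  have pw: "real n powr (4/3) = ?r * real n"
    using pos powr_add[of "real n" "1/3" 1] by simp
  have "real (card C)^2 / real k ^ 2 \<le> real n ^ 2 / ?r ^ 2"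
    using n k r1 pos by (intro frac_le power_mono zero_less_power) auto
  also have "\<dots> = real n powr (4/3)"
  proof -
    have "real n ^ 2 = real n powr 2" "?r ^ 2 = real n powr (2/3)"
      using pos by (simp_all add: powr_numeral powr_power)
    then show ?thesis by (simp only: powr_diff[symmetric]) simp
  qed
  finally have 1: "(real (card C))\<^sup>2 / (real k)\<^sup>2 \<le> real n powr (4/3)" .
  have "real k * real (card P) \<le> (2 * ?r) * real n"
    using k n by (intro mult_mono) auto
  then have 2: "3 * real k * real (card P) \<le> 6 * real n powr (4/3)" unfolding pw by (simp add: ac_simps)
  have "1 * real n \<le> ?r * real n" using r1 by (intro mult_right_mono) auto
  then have 3: "real (card C) \<le> real n powr (4/3)" unfolding pw using n by simp
  have "real (card incidences) \<le> real (card C) + real (card segments)"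
    using of_nat_mono[OF card_incidences_le_segments, where 'a = real] by simp
  then show ?thesis using card_segments[OF k1] 1 2 3 by linarith
qed

end

section \<open>Pairs and triples of points in the plane\<close>

lemma inner_2: "x \<bullet> y = x$1 * y$1 + x$2 * y$2" for x y :: "real^2"
  by (simp add: inner_vec_def sum_2)

lemma norm_diff_eq_2:
  fixes x y :: "real^2"
  assumes "c \<ge> 0"
  shows "norm (x - y) = c \<longleftrightarrow> (x$1 - y$1)\<^sup>2 + (x$2 - y$2)\<^sup>2 = c\<^sup>2"
proof -
  have "(norm (x - y))\<^sup>2 = (x$1 - y$1)\<^sup>2 + (x$2 - y$2)\<^sup>2"
    unfolding power2_norm_eq_inner inner_2 by (simp add: power2_eq_square)
  moreover have "norm (x - y) = c \<longleftrightarrow> (norm (x - y))\<^sup>2 = c\<^sup>2"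
    using assms by simp
  ultimately show ?thesis by simp
qed

text \<open>Two distinct translates of an upper semicircle meet at most once: if both pass through
  \<open>(t, u)\<close> and \<open>(t', u')\<close>, the centres are mirror images in the line joining these points,
  hence have mean height \<open>(u + u') / 2\<close>; but neither is higher than either point.\<close>

lemma semicircles_meet_once:
  fixes a b a' b' t u t' u' r :: real
  assumes p: "(t - a)\<^sup>2 + (u - b)\<^sup>2 = r\<^sup>2" "(t' - a)\<^sup>2 + (u' - b)\<^sup>2 = r\<^sup>2"
    and q: "(t - a')\<^sup>2 + (u - b')\<^sup>2 = r\<^sup>2" "(t' - a')\<^sup>2 + (u' - b')\<^sup>2 = r\<^sup>2"
    and up: "b \<le> u" "b \<le> u'" "b' \<le> u" "b' \<le> u'"
    and ne: "t \<noteq> t'"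
  shows "a = a' \<and> b = b'"
proof (rule ccontr)
  assume neq: "\<not> (a = a' \<and> b = b')"
  define m where "m = t' - t"
  define h where "h = u' - u"
  \<comment> \<open>Subtracting circle equations: each of the two points is equidistant from the two
    centres (\<open>l1\<close>, \<open>l2\<close>), and each centre is equidistant from the two
    points (\<open>c1\<close>, \<open>c2\<close>).\<close>
  have l1: "(2 * t - a - a') * (a' - a) + (2 * u - b - b') * (b' - b) = 0"
    using p(1) q(1) by (simp add: power2_eq_square algebra_simps)
  have l2: "(2 * t' - a - a') * (a' - a) + (2 * u' - b - b') * (b' - b) = 0"
    using p(2) q(2) by (simp add: power2_eq_square algebra_simps)
  have perp: "m * (a' - a) + h * (b' - b) = 0"
    using l1 l2 unfolding m_def h_def by (simp add: algebra_simps)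
  have m: "m \<noteq> 0" using ne unfolding m_def by simp
  have bb: "b' \<noteq> b" using perp m neq by auto
  have c1: "m * (t + t' - 2 * a) + h * (u + u' - 2 * b) = 0"
    using p unfolding m_def h_def by (simp add: power2_eq_square algebra_simps)
  have c2: "m * (t + t' - 2 * a') + h * (u + u' - 2 * b') = 0"
    using q unfolding m_def h_def by (simp add: power2_eq_square algebra_simps)
  have s: "(t + t' - a - a') * (a' - a) + (u + u' - b - b') * (b' - b) = 0"
    using l1 l2 by (simp add: algebra_simps)
  have c: "m * (t + t' - a - a') + h * (u + u' - b - b') = 0"
    using c1 c2 by (simp add: algebra_simps)
  \<comment> \<open>The vector \<open>(t + t' - a - a', u + u' - b - b')\<close> is orthogonal to
    the chord \<open>(m, h)\<close> and to the difference of the centres, which are nonzero and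
    orthogonal to each other. So it vanishes; the identity extracts its second coordinate.\<close>
  have "(u + u' - b - b') * (m * m + h * h) * (b' - b) = 0"
    using s c perp by algebra
  moreover have "m * m + h * h > 0" using m by (simp add: add_pos_nonneg flip: power2_eq_square)
  ultimately have "u + u' - b - b' = 0" using bb by (metis mult_eq_0_iff less_irrefl right_minus_eq)
  then have "u = b \<and> u' = b \<and> b' = b" using up by linarith
  then show False using bb by simp
qed

text \<open>Cramer's rule: the coefficients solve a linear system with determinant
  \<open>t * u' - t' * u\<close>. Were this zero, the two points would be collinear with the origin,
  although they lie on a non-vertical direction along a line missing it.\<close>

lemma lines_meet_once:
  fixes a b a' b' t u t' u' c :: real
  assumes "a * t + b * u = c" "a * t' + b * u' = c" "a' * t + b' * u = c" "a' * t' + b' * u' = c"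
    and c: "c \<noteq> 0" and ne: "t \<noteq> t'"
  shows "a = a' \<and> b = b'"
proof -
  have d: "t * u' - t' * u \<noteq> 0"
  proof
    assume z: "t * u' - t' * u = 0"
    have "c * t' = (a * t + b * u) * t'" "c * t = (a * t' + b * u') * t"
      using assms(1,2) by simp_all
    then have "c * (t' - t) = - b * (t * u' - t' * u)" by (simp add: algebra_simps)
    then have "c * (t' - t) = 0" using z by simp
    then show False using c ne by simp
  qed
  have "(t * u' - t' * u) * (a - a') = (a * t + b * u - (a' * t + b' * u)) * u'
      - (a * t' + b * u' - (a' * t' + b' * u')) * u"
    "(t * u' - t' * u) * (b - b') = (a * t' + b * u' - (a' * t' + b' * u')) * t
      - (a * t + b * u - (a' * t + b' * u)) * t'"
    by (simp_all add: algebra_simps)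
  then show ?thesis using d assms by simp
qed

section \<open>Pairs with prescribed distance or dot product\<close>

lemma card_upper_distance_pairs:
  fixes P :: "(real^2) set"
  assumes P: "finite P" "P \<noteq> {}" and c: "c > 0"
  shows "real (card {(x, y) \<in> P \<times> P. norm (x - y) = c \<and> x$2 \<le> y$2}) \<le> 8 * real (card P) powr (4/3)"
proof -
  define pt where "pt = (\<lambda>y :: real^2. (y$1, y$2))"
  have inj: "inj pt" unfolding pt_def inj_def by (auto simp: vec_eq_iff forall_2)
  define D where "D = (\<lambda>x :: real^2. {x$1 - c .. x$1 + c})"
  define F where "F = (\<lambda>(x :: real^2) t. x$2 + sqrt (c\<^sup>2 - (t - x$1)\<^sup>2))"
  have onF: "(t - x$1)\<^sup>2 + (F x t - x$2)\<^sup>2 = c\<^sup>2 \<and> x$2 \<le> F x t" if "t \<in> D x" for x t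
  proof -
    have "\<bar>t - x$1\<bar> \<le> \<bar>c\<bar>" using that c unfolding D_def by auto
    then have "(t - x$1)\<^sup>2 \<le> c\<^sup>2" by (simp add: abs_le_square_iff)
    then show ?thesis unfolding F_def by simp
  qed
  \<comment> \<open>The curve of \<open>x\<close> is the upper semicircle of radius \<open>c\<close>
    about \<open>x\<close>; it passes through \<open>y\<close> exactly when \<open>y\<close> is at
    distance \<open>c\<close> from \<open>x\<close> and not lower than \<open>x\<close>.\<close>
  interpret curve_arrangement P D F "pt ` P"
  proof
    show "finite P" "finite (pt ` P)" using P by auto
    show "convex (D i)" "continuous_on (D i) (F i)" for i
      unfolding D_def F_def by (auto intro!: continuous_intros)
    fix i j :: "real^2" and x y
    assume *: "i \<noteq> j" "x \<in> D i \<inter> D j" "y \<in> D i \<inter> D j" "F i x = F j x" "F i y = F j y"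
    show "x = y"
    proof (rule ccontr)
      assume "x \<noteq> y"
      then have "i$1 = j$1 \<and> i$2 = j$2"
        using * onF[of x i] onF[of y i] onF[of x j] onF[of y j]
        by (intro semicircles_meet_once[of x "i$1" "F i x" "i$2" c y "F i y"]) auto
      then show False using * by (auto simp: vec_eq_iff forall_2)
    qed
  qed
  have "card {(x, y) \<in> P \<times> P. norm (x - y) = c \<and> x$2 \<le> y$2} \<le> card incidences"
  proof (rule card_inj_on_le[OF _ _ finite_incidences])
    show "(\<lambda>(x, y). (x, y$1)) ` {(x, y) \<in> P \<times> P. norm (x - y) = c \<and> x$2 \<le> y$2} \<subseteq> incidences"
      and "inj_on (\<lambda>(x, y). (x, y$1)) {(x, y) \<in> P \<times> P. norm (x - y) = c \<and> x$2 \<le> y$2}"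
    proof -
      have inc: "y$1 \<in> D x \<and> F x (y$1) = y$2" if "norm (x - y) = c" "x$2 \<le> y$2" for x y
      proof -
        have eq: "(x$1 - y$1)\<^sup>2 + (x$2 - y$2)\<^sup>2 = c\<^sup>2"
          using that c norm_diff_eq_2[of c x y] by simp
        then have "(x$1 - y$1)\<^sup>2 \<le> c\<^sup>2" using zero_le_power2[of "x$2 - y$2"] by linarith
        then have "\<bar>x$1 - y$1\<bar> \<le> c" using c by (simp add: abs_le_square_iff[symmetric])
        moreover have "c\<^sup>2 - (y$1 - x$1)\<^sup>2 = (y$2 - x$2)\<^sup>2"
          using eq by (simp add: power2_commute)
        ultimately show ?thesis using that unfolding D_def F_def by (auto simp: real_sqrt_abs)
      qed
      show "(\<lambda>(x, y). (x, y$1)) ` {(x, y) \<in> P \<times> P. norm (x - y) = c \<and> x$2 \<le> y$2} \<subseteq> incidences"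
      proof clarify
        fix x y assume xy: "x \<in> P" "y \<in> P" "x$2 \<le> y$2" "c = norm (x - y)"
        then have *: "y$1 \<in> D x" "(y$1, F x (y$1)) = pt y" using inc[of x y] unfolding pt_def by auto
        show "(x, y$1) \<in> incidences" using xy * unfolding incidences_def by simp
      qed
      show "inj_on (\<lambda>(x, y). (x, y$1)) {(x, y) \<in> P \<times> P. norm (x - y) = c \<and> x$2 \<le> y$2}"
        \<comment> \<open>The second point is recovered from its abscissa by evaluating the
          semicircle there.\<close>
        by (rule inj_on_inverseI[where g = "\<lambda>(x, t). (x, vector [t, F x t])"])
          (use inc in \<open>auto simp: vec_eq_iff forall_2\<close>)
    qed
  qed
  moreover have "real (card incidences) \<le> 8 * real (card P) powr (4/3)"
    using P card_image_le[OF P(1), of pt] by (intro card_incidences) (auto simp: Suc_le_eq card_gt_0_iff)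
  ultimately show ?thesis by linarith
qed

text \<open>Swapping the two points if necessary makes the second one not lower than the first,
  which doubles the bound for upper pairs.\<close>

theorem card_distance_pairs:
  fixes P :: "(real^2) set"
  assumes P: "finite P"
  shows "real (card {(x, y) \<in> P \<times> P. x \<noteq> y \<and> norm (x - y) = c}) \<le> 16 * real (card P) powr (4/3)"
proof (cases "P = {} \<or> c \<le> 0")
  case True
  have "{(x, y) \<in> P \<times> P. x \<noteq> y \<and> norm (x - y) = c} = {}"
  proof (rule ccontr)
    assume "\<not> ?thesis"
    then obtain x y where "x \<in> P" "x \<noteq> y" "norm (x - y) = c" by auto
    moreover from \<open>x \<noteq> y\<close> have "norm (x - y) > 0" by simp
    ultimately show False using True by auto
  qed
  then show ?thesis by (simp only: card.empty) simp
next
  case False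
  let ?U = "{(x, y) \<in> P \<times> P. norm (x - y) = c \<and> x$2 \<le> y$2}"
  have "finite ?U" using P by (auto intro: finite_subset[of _ "P \<times> P"])
  have "{(x, y) \<in> P \<times> P. x \<noteq> y \<and> norm (x - y) = c} \<subseteq> ?U \<union> prod.swap ` ?U"
  proof (rule subsetI)
    fix q assume "q \<in> {(x, y) \<in> P \<times> P. x \<noteq> y \<and> norm (x - y) = c}"
    then obtain x y where q: "q = (x, y)" "x \<in> P" "y \<in> P" "norm (x - y) = c" by auto
    show "q \<in> ?U \<union> prod.swap ` ?U"
    proof (cases "x$2 \<le> y$2")
      case True
      then show ?thesis using q by simp
    next
      case False
      then have "(y, x) \<in> ?U" using q by (simp add: norm_minus_commute)
      then show ?thesis using q by (intro UnI2 image_eqI[of _ _ "(y, x)"]) auto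
    qed
  qed
  then have "card {(x, y) \<in> P \<times> P. x \<noteq> y \<and> norm (x - y) = c} \<le> card (?U \<union> prod.swap ` ?U)"
    using \<open>finite ?U\<close> by (intro card_mono) auto
  also have "\<dots> \<le> card ?U + card (prod.swap ` ?U)" by (rule card_Un_le)
  also have "\<dots> \<le> 2 * card ?U" using card_image_le[OF \<open>finite ?U\<close>, of prod.swap] by simp
  finally show ?thesis
    using card_upper_distance_pairs[OF P, of c] False by simp
qed

text \<open>The points \<open>y\<close> with \<open>x \<bullet> y = c\<close> form a line, and as
  \<open>c\<close> is nonzero, distinct \<open>x\<close> give distinct lines. The vertical ones,
  with \<open>x$2 = 0\<close>, are no graphs and are counted directly. The constant
  \<open>16\<close> is chosen to agree with the distance case.\<close>

theorem card_dot_pairs: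
  fixes P :: "(real^2) set"
  assumes P: "finite P" and c: "c \<noteq> 0"
  shows "real (card {(x, y) \<in> P \<times> P. x \<noteq> y \<and> x \<bullet> y = c}) \<le> 16 * real (card P) powr (4/3)"
proof (cases "P = {}")
  case True
  then show ?thesis by simp
next
  case False
  then have n1: "card P \<ge> 1" using P by (simp add: Suc_le_eq card_gt_0_iff)
  define pt where "pt = (\<lambda>y :: real^2. (y$1, y$2))"
  define D where "D = (\<lambda>x :: real^2. UNIV :: real set)"
  define F where "F = (\<lambda>(x :: real^2) t. (c - x$1 * t) / x$2)"
  let ?C = "{x \<in> P. x$2 \<noteq> 0}"
  interpret curve_arrangement ?C D F "pt ` P"
  proof
    show "finite ?C" "finite (pt ` P)" using P by auto
    show "convex (D i)" "continuous_on (D i) (F i)" if "i \<in> ?C" for i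
      using that unfolding D_def F_def by (auto intro!: continuous_intros)
    fix i j :: "real^2" and x y
    assume *: "i \<in> ?C" "j \<in> ?C" "i \<noteq> j" "F i x = F j x" "F i y = F j y"
    show "x = y"
    proof (rule ccontr)
      assume "x \<noteq> y"
      then have "i$1 = j$1 \<and> i$2 = j$2"
        using * c unfolding F_def
        by (intro lines_meet_once[of "i$1" x "i$2" "F i x" c y "F i y"]) (auto simp: F_def field_simps)
      then show False using * by (auto simp: vec_eq_iff forall_2)
    qed
  qed
  let ?V = "{(x, y) \<in> P \<times> P. x$2 = 0 \<and> x \<bullet> y = c}"
  let ?N = "{(x, y) \<in> P \<times> P. x$2 \<noteq> 0 \<and> x \<bullet> y = c}"
  have "card ?N \<le> card incidences"
  proof (rule card_inj_on_le[OF _ _ finite_incidences])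
    have inc: "F x (y$1) = y$2" if "x$2 \<noteq> 0" "x \<bullet> y = c" for x y
      using that unfolding F_def inner_2 by (auto simp: field_simps)
    show "(\<lambda>(x, y). (x, y$1)) ` ?N \<subseteq> incidences"
    proof clarify
      fix x y assume xy: "x \<in> P" "y \<in> P" "x$2 \<noteq> 0" "c = x \<bullet> y"
      then have "(y$1, F x (y$1)) = pt y" using inc[of x y] unfolding pt_def by auto
      then show "(x, y$1) \<in> incidences" using xy unfolding incidences_def by (simp add: D_def)
    qed
    show "inj_on (\<lambda>(x, y). (x, y$1)) ?N"
      by (rule inj_on_inverseI[where g = "\<lambda>(x, t). (x, vector [t, F x t])"])
        (use inc in \<open>auto simp: vec_eq_iff forall_2\<close>)
  qed
  moreover have "real (card incidences) \<le> 8 * real (card P) powr (4/3)"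
    using n1 P card_image_le[OF P(1), of pt]
    by (intro card_incidences) (auto intro: card_mono)
  \<comment> \<open>For \<open>x$2 = 0\<close> the equation reads \<open>x$1 * y$1 = c\<close> with
    \<open>c\<close> nonzero, so \<open>y\<close> determines \<open>x\<close>.\<close>
  moreover have "card ?V \<le> card P"
  proof (rule card_inj_on_le[OF _ _ P])
    show "inj_on snd ?V"
      using c by (auto simp: inj_on_def inner_2 vec_eq_iff forall_2)
  qed auto
  moreover have "real (card P) \<le> real (card P) powr (4/3)"
    using powr_mono[of 1 "4/3" "real (card P)"] n1 by simp
  moreover have "card {(x, y) \<in> P \<times> P. x \<noteq> y \<and> x \<bullet> y = c} \<le> card (?N \<union> ?V)"
    using P by (intro card_mono) (auto intro: finite_subset[of _ "P \<times> P"])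
  moreover have "card (?N \<union> ?V) \<le> card ?N + card ?V" by (rule card_Un_le)
  ultimately show ?thesis by linarith
qed

section \<open>Triples with two prescribed distances or dot products\<close>

lemma circle_intersection_side:
  fixes p q p' q' d e :: real
  assumes c: "p\<^sup>2 + q\<^sup>2 = p'\<^sup>2 + q'\<^sup>2" "(p - d)\<^sup>2 + (q - e)\<^sup>2 = (p' - d)\<^sup>2 + (q' - e)\<^sup>2"
    and side: "0 \<le> p * e - q * d \<longleftrightarrow> 0 \<le> p' * e - q' * d"
    and ne: "\<not> (d = 0 \<and> e = 0)"
  shows "p = p' \<and> q = q'"
proof -
  have i: "p * d + q * e = p' * d + q' * e"
    using c by (simp add: power2_eq_square algebra_simps)
  \<comment> \<open>Lagrange's identity yields the square of the cross product with
    \<open>(d, e)\<close>, and \<open>side\<close> fixes its sign. Scalar and cross product together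
    determine \<open>(p, q)\<close>.\<close>
  have lagrange: "(p * e - q * d)\<^sup>2 = (p\<^sup>2 + q\<^sup>2) * (d\<^sup>2 + e\<^sup>2) - (p * d + q * e)\<^sup>2" for p q
    by (simp add: power2_eq_square algebra_simps)
  have "(p * e - q * d)\<^sup>2 = (p' * e - q' * d)\<^sup>2"
    unfolding lagrange c(1) i ..
  then have j: "p * e - q * d = p' * e - q' * d"
    using side unfolding power2_eq_iff by argo
  have "(p - p') * (d * d + e * e) = ((p * d + q * e) - (p' * d + q' * e)) * d
      + ((p * e - q * d) - (p' * e - q' * d)) * e"
    by (simp add: algebra_simps)
  then have "(p - p') * (d * d + e * e) = 0" using i j by simp
  moreover have "(q - q') * (d * d + e * e) = ((p * d + q * e) - (p' * d + q' * e)) * e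
      - ((p * e - q * d) - (p' * e - q' * d)) * d"
    by (simp add: algebra_simps)
  then have "(q - q') * (d * d + e * e) = 0" using i j by simp
  moreover have "d * d + e * e \<noteq> 0"
    using ne by (simp add: sum_squares_eq_zero_iff)
  ultimately show ?thesis unfolding mult_eq_0_iff right_minus_eq by blast
qed

text \<open>The constant \<open>2\<close> is weakened to \<open>16\<close>, the constant of the bounds for pairs.\<close>

lemma card_le_two_squares:
  assumes "finite P" "inj_on f T" "f ` T \<subseteq> P \<times> P \<times> (UNIV :: bool set)"
  shows "real (card T) \<le> 16 * real (card P) powr 2"
proof -
  have "card T \<le> card (P \<times> P \<times> (UNIV :: bool set))"
    using assms by (intro card_inj_on_le[of f]) auto
  also have "\<dots> = 2 * (card P)\<^sup>2" by (simp add: card_cartesian_product power2_eq_square)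
  finally have "real (card T) \<le> 2 * (real (card P))\<^sup>2"
    using of_nat_mono by fastforce
  also have "\<dots> \<le> 16 * real (card P) powr 2"
    by (cases "card P = 0") (simp_all add: powr_numeral)
  finally show ?thesis .
qed

text \<open>The middle point lies on two circles about \<open>x\<close> and \<open>z\<close>; the
  side of the line through \<open>x\<close> and \<open>z\<close> singles out one of their at most
  two intersections.\<close>

lemma card_distance_triples:
  fixes P :: "(real^2) set"
  assumes P: "finite P"
  shows "real (card {(x, y, z) \<in> P \<times> P \<times> P. x \<noteq> y \<and> y \<noteq> z \<and> x \<noteq> z \<and>
    norm (x - y) = c \<and> norm (y - z) = c'}) \<le> 16 * real (card P) powr 2" (is "real (card ?T) \<le> _")
proof (rule card_le_two_squares[OF P])
  let ?side = "\<lambda>x y z :: real^2. 0 \<le> (y$1 - x$1) * (z$2 - x$2) - (y$2 - x$2) * (z$1 - x$1)"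
  show "(\<lambda>(x, y, z). (x, z, ?side x y z)) ` ?T \<subseteq> P \<times> P \<times> UNIV" by auto
  show "inj_on (\<lambda>(x, y, z). (x, z, ?side x y z)) ?T"
  proof (rule inj_onI)
    fix p q assume "p \<in> ?T" "q \<in> ?T"
      and "(\<lambda>(x, y, z). (x, z, ?side x y z)) p = (\<lambda>(x, y, z). (x, z, ?side x y z)) q"
    then obtain x y y' z where pq: "p = (x, y, z)" "q = (x, y', z)"
      and n: "x \<noteq> z" "norm (x - y) = c" "norm (y - z) = c'" "norm (x - y') = c" "norm (y' - z) = c'"
      and side: "?side x y z = ?side x y' z"
      by (cases p; cases q) auto
    have c: "0 \<le> c" "0 \<le> c'" using n(2,3) by auto
    have "y$1 - x$1 = y'$1 - x$1 \<and> y$2 - x$2 = y'$2 - x$2"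
    proof (rule circle_intersection_side[OF _ _ side])
      show "\<not> (z$1 - x$1 = 0 \<and> z$2 - x$2 = 0)" using n(1) by (auto simp: vec_eq_iff forall_2)
      show "(y$1 - x$1)\<^sup>2 + (y$2 - x$2)\<^sup>2 = (y'$1 - x$1)\<^sup>2 + (y'$2 - x$2)\<^sup>2"
        using n(2,4) unfolding norm_diff_eq_2[OF c(1)] by (simp add: power2_commute)
      show "(y$1 - x$1 - (z$1 - x$1))\<^sup>2 + (y$2 - x$2 - (z$2 - x$2))\<^sup>2 =
          (y'$1 - x$1 - (z$1 - x$1))\<^sup>2 + (y'$2 - x$2 - (z$2 - x$2))\<^sup>2"
        using n(3,5) unfolding norm_diff_eq_2[OF c(2)] by simp
    qed
    then show "p = q" unfolding pq by (simp add: vec_eq_iff forall_2)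
  qed
qed

text \<open>If \<open>x\<close> and \<open>z\<close> are not parallel, two independent linear
  equations determine \<open>y\<close>. If they are parallel, then \<open>c\<close> times
  \<open>z\<close> equals \<open>c'\<close> times \<open>x\<close>, so \<open>z\<close> is
  determined and the code stores \<open>y\<close> in its place; the flag tells the cases
  apart.\<close>

lemma card_dot_triples:
  fixes P :: "(real^2) set"
  assumes P: "finite P" and c: "c \<noteq> 0"
  shows "real (card {(x, y, z) \<in> P \<times> P \<times> P. x \<noteq> y \<and> y \<noteq> z \<and> x \<noteq> z \<and>
    x \<bullet> y = c \<and> y \<bullet> z = c'}) \<le> 16 * real (card P) powr 2" (is "real (card ?T) \<le> _")
proof (rule card_le_two_squares[OF P])
  let ?par = "\<lambda>x z :: real^2. x$1 * z$2 = x$2 * z$1"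
  let ?f = "\<lambda>(x, y, z). (x, if ?par x z then y else z, ?par x z)"
  show "?f ` ?T \<subseteq> P \<times> P \<times> UNIV" by auto
  show "inj_on ?f ?T"
  proof (rule inj_onI)
    fix p q assume "p \<in> ?T" "q \<in> ?T" and f: "?f p = ?f q"
    then obtain x y z y' z' where pq: "p = (x, y, z)" "q = (x, y', z')"
      and n: "x \<bullet> y = c" "y \<bullet> z = c'" "x \<bullet> y' = c" "y' \<bullet> z' = c'"
      by (cases p; cases q) auto
    have par: "?par x z \<longleftrightarrow> ?par x z'" using f unfolding pq by simp
    show "p = q"
    proof (cases "?par x z")
      case True
      then have y: "y' = y" using f unfolding pq by auto
      have "c * z$1 = c' * x$1 \<and> c * z$2 = c' * x$2"
        if z: "?par x z" "y \<bullet> z = c'" for z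
      proof -
        have "c * z$1 = (x$1 * y$1) * z$1 + y$2 * (x$2 * z$1)"
          "c * z$2 = y$1 * (x$1 * z$2) + (x$2 * y$2) * z$2"
          using n(1) unfolding inner_2 by (auto simp: algebra_simps)
        moreover have "c' * x$1 = (x$1 * y$1) * z$1 + y$2 * (x$1 * z$2)"
          "c' * x$2 = y$1 * (x$2 * z$1) + (x$2 * y$2) * z$2"
          using z(2) unfolding inner_2 by (auto simp: algebra_simps)
        ultimately show ?thesis using z(1) by simp
      qed
      from this[of z] this[of z'] have "c * z$1 = c * z'$1" "c * z$2 = c * z'$2"
        using True par n y by auto
      then show ?thesis using c y unfolding pq by (simp add: vec_eq_iff forall_2)
    next
      case False
      then have z: "z' = z" using f par unfolding pq by auto
      define a b where "a = y$1 - y'$1" and "b = y$2 - y'$2"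
      have ab: "x$1 * a + x$2 * b = 0" "z$1 * a + z$2 * b = 0"
        using n z unfolding inner_2 a_def b_def by (auto simp: algebra_simps)
      \<comment> \<open>Cramer's rule for \<open>y - y'\<close>, which is orthogonal to the
        independent vectors \<open>x\<close> and \<open>z\<close>.\<close>
      have "(x$1 * z$2 - x$2 * z$1) * a = z$2 * (x$1 * a + x$2 * b) - x$2 * (z$1 * a + z$2 * b)"
        "(x$1 * z$2 - x$2 * z$1) * b = x$1 * (z$1 * a + z$2 * b) - z$1 * (x$1 * a + x$2 * b)"
        by (simp_all add: algebra_simps)
      then have "a = 0" "b = 0" using ab False by auto
      then show ?thesis using z unfolding pq a_def b_def by (simp add: vec_eq_iff forall_2)
    qed
  qed
qed

section \<open>Covered graphs\<close>

lemma copy_in_path_2: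
  assumes "copy_in (path_graph 2) G H"
  obtains u v where "u \<noteq> v" "verts H = {u, v}" "{u, v} \<in> edges H"
proof -
  obtain f where f: "bij_betw f (verts (path_graph 2)) (verts H)"
    "edges H = (\<lambda>e. f ` e) ` edges (path_graph 2)"
    using assms unfolding copy_in_def graph_iso_def by blast
  have V: "verts (path_graph 2) = {0, 1}" and E: "{0, 1} \<in> edges (path_graph 2)"
    unfolding path_graph_def by auto
  show ?thesis
  proof (rule that)
    show "f 0 \<noteq> f 1" using f(1) unfolding V bij_betw_def by auto
    show "verts H = {f 0, f 1}" using f(1) unfolding V bij_betw_def by auto
    have "f ` {0, 1} \<in> edges H" unfolding f(2) using E by (rule imageI)
    then show "{f 0, f 1} \<in> edges H" by simp
  qed
qed

lemma copy_in_path_3: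
  assumes "copy_in (path_graph 3) G H"
  obtains u v z where "u \<noteq> v" "v \<noteq> z" "u \<noteq> z" "verts H = {u, v, z}" "{u, v} \<in> edges H" "{v, z} \<in> edges H"
proof -
  obtain f where f: "bij_betw f (verts (path_graph 3)) (verts H)"
    "edges H = (\<lambda>e. f ` e) ` edges (path_graph 3)"
    using assms unfolding copy_in_def graph_iso_def by blast
  have V: "verts (path_graph 3) = {0, 1, 2}" unfolding path_graph_def by auto
  have E: "{0, 1} \<in> edges (path_graph 3)" "{1, 2} \<in> edges (path_graph 3)"
  proof -
    have "{i, Suc i} \<in> edges (path_graph 3)" if "Suc i < 3" for i
      using that unfolding path_graph_def by auto
    from this[of 0] this[of 1] show "{0, 1} \<in> edges (path_graph 3)" "{1, 2} \<in> edges (path_graph 3)"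
      by (simp_all add: numeral_2_eq_2)
  qed
  have "f 0 \<noteq> f 1" "f 1 \<noteq> f 2" "f 0 \<noteq> f 2" "verts H = {f 0, f 1, f 2}"
    using f(1) unfolding V bij_betw_def by auto
  moreover have "f ` {0, 1} \<in> edges H" "f ` {1, 2} \<in> edges H"
    using imageI[OF E(1), of "\<lambda>e. f ` e"] imageI[OF E(2), of "\<lambda>e. f ` e"] unfolding f(2) .
  ultimately show ?thesis using that[of "f 0" "f 1" "f 2"] by simp
qed

text \<open>\<open>R\<close> stands for the distance or the dot product, so that both halves of the
  theorem share one argument. Extensional functions give each map on the vertices a single
  representative.\<close>

definition embeddings ::
  "('a \<Rightarrow> 'a \<Rightarrow> real) \<Rightarrow> 'a set \<Rightarrow> ('v set \<Rightarrow> real) \<Rightarrow> 'v graph \<Rightarrow> ('v \<Rightarrow> 'a) set" where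
  "embeddings R P w H = {\<psi> \<in> verts H \<rightarrow>\<^sub>E P. inj_on \<psi> (verts H) \<and>
     (\<forall>u v. {u, v} \<in> edges H \<longrightarrow> R (\<psi> u) (\<psi> v) = w {u, v})}"

section \<open>Counting embeddings path by path\<close>

lemma finite_embeddings: "finite P \<Longrightarrow> finite (verts H) \<Longrightarrow> finite (embeddings R P w H)"
  unfolding embeddings_def by (simp add: finite_PiE)

lemma card_embeddings_2:
  assumes P: "finite P" and H: "u \<noteq> v" "verts H = {u, v}" "{u, v} \<in> edges H"
  shows "card (embeddings R P w H) \<le> card {(x, y) \<in> P \<times> P. x \<noteq> y \<and> R x y = w {u, v}}"
proof (rule card_inj_on_le)
  show "inj_on (\<lambda>\<psi>. (\<psi> u, \<psi> v)) (embeddings R P w H)"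
    by (rule inj_onI, rule PiE_ext[of _ "verts H" "\<lambda>_. P"]) (auto simp: embeddings_def H(2))
  show "(\<lambda>\<psi>. (\<psi> u, \<psi> v)) ` embeddings R P w H \<subseteq> {(x, y) \<in> P \<times> P. x \<noteq> y \<and> R x y = w {u, v}}"
    using H unfolding embeddings_def by (auto simp: inj_on_def)
  show "finite {(x, y) \<in> P \<times> P. x \<noteq> y \<and> R x y = w {u, v}}"
    using P by (auto intro: finite_subset[of _ "P \<times> P"])
qed

lemma card_embeddings_3:
  assumes P: "finite P"
    and H: "u \<noteq> v" "v \<noteq> z" "u \<noteq> z" "verts H = {u, v, z}" "{u, v} \<in> edges H" "{v, z} \<in> edges H"
  shows "card (embeddings R P w H) \<le> card {(x, y, z') \<in> P \<times> P \<times> P. x \<noteq> y \<and> y \<noteq> z' \<and> x \<noteq> z' \<and>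
    R x y = w {u, v} \<and> R y z' = w {v, z}}" (is "_ \<le> card ?T")
proof (rule card_inj_on_le)
  show "inj_on (\<lambda>\<psi>. (\<psi> u, \<psi> v, \<psi> z)) (embeddings R P w H)"
    by (rule inj_onI, rule PiE_ext[of _ "verts H" "\<lambda>_. P"]) (auto simp: embeddings_def H(4))
  show "(\<lambda>\<psi>. (\<psi> u, \<psi> v, \<psi> z)) ` embeddings R P w H \<subseteq> ?T"
    using H unfolding embeddings_def by (auto simp: inj_on_def)
  show "finite ?T"
    using P by (auto intro: finite_subset[of _ "P \<times> P \<times> P"])
qed

text \<open>An embedding restricts to an embedding of each piece, and since the pieces cover all
  vertices, the restrictions determine it.\<close>

lemma card_embeddings_cover:
  assumes P: "finite P" and V: "finite (verts G)" and I: "finite I"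
    and cover: "(\<Union>H\<in>I. verts H) = verts G"
    and sub: "\<And>H. H \<in> I \<Longrightarrow> subgraph H G"
  shows "card (embeddings R P w G) \<le> (\<Prod>H\<in>I. card (embeddings R P w H))"
proof -
  have "card (embeddings R P w G) \<le> card (Pi\<^sub>E I (embeddings R P w))"
  proof (rule card_inj_on_le)
    let ?f = "\<lambda>\<phi>. \<lambda>H\<in>I. restrict \<phi> (verts H)"
    show "inj_on ?f (embeddings R P w G)"
    proof (rule inj_onI)
      fix \<phi> \<psi> assume e: "\<phi> \<in> embeddings R P w G" "\<psi> \<in> embeddings R P w G" and eq: "?f \<phi> = ?f \<psi>"
      show "\<phi> = \<psi>"
      proof (rule PiE_ext[of _ "verts G" "\<lambda>_. P"])
        show "\<phi> \<in> verts G \<rightarrow>\<^sub>E P" "\<psi> \<in> verts G \<rightarrow>\<^sub>E P" using e unfolding embeddings_def by auto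
        fix v assume "v \<in> verts G"
        then obtain H where H: "H \<in> I" "v \<in> verts H" using cover by blast
        have "?f \<phi> H v = ?f \<psi> H v" using eq by simp
        then show "\<phi> v = \<psi> v" using H by simp
      qed
    qed
    show "?f ` embeddings R P w G \<subseteq> Pi\<^sub>E I (embeddings R P w)"
    proof (rule image_subsetI, rule restrict_PiE_iff[THEN iffD2], rule ballI)
      fix \<phi> H assume e: "\<phi> \<in> embeddings R P w G" and H: "H \<in> I"
      \<comment> \<open>An edge of \<open>H\<close> has both ends in \<open>verts H\<close>, so the
        default value of \<open>restrict\<close> never enters the edge condition.\<close>
      have s: "verts H \<subseteq> verts G" "edges H \<subseteq> edges G" "\<And>e. e \<in> edges H \<Longrightarrow> e \<subseteq> verts H"
        using sub[OF H] unfolding subgraph_def simple_graph_def by auto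
      have "R (restrict \<phi> (verts H) u) (restrict \<phi> (verts H) v) = w {u, v}" if "{u, v} \<in> edges H" for u v
        using that s(2) s(3)[OF that] e unfolding embeddings_def by auto
      then show "restrict \<phi> (verts H) \<in> embeddings R P w H"
        using e s(1) inj_on_subset[of \<phi> "verts G" "verts H"] unfolding embeddings_def
        by (auto simp: inj_on_restrict_eq)
    qed
    show "finite (Pi\<^sub>E I (embeddings R P w))"
    proof (rule finite_PiE[OF I])
      fix H assume "H \<in> I"
      then have "finite (verts H)" using sub unfolding subgraph_def simple_graph_def by blast
      then show "finite (embeddings R P w H)" by (rule finite_embeddings[OF P])
    qed
  qed
  then show ?thesis using card_PiE[OF I, of "embeddings R P w"] by simp
qed

text \<open>Every configuration is the image of some list of vertices under some embedding, and the
  number of such lists depends on \<open>G\<close> only.\<close>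

lemma card_configs_le_embeddings:
  assumes P: "finite P" and V: "finite (verts G)"
    and G: "\<And>e. e \<in> edges G \<Longrightarrow> e \<subseteq> verts G"
  shows "card {X. set X \<subseteq> P \<and> length X = card (verts G) \<and>
      (\<exists>\<phi>. bij_betw \<phi> (verts G) (set X) \<and>
        (\<forall>u v. {u, v} \<in> edges G \<longrightarrow> R (\<phi> u) (\<phi> v) = w {u, v}))}
    \<le> card (embeddings R P w G) * card (verts G) ^ card (verts G)"
    (is "card ?X \<le> _")
proof -
  let ?U = "{us. set us \<subseteq> verts G \<and> length us = card (verts G)}"
  let ?S = "embeddings R P w G \<times> ?U"
  have finS: "finite ?S" using P V by (simp add: finite_embeddings finite_lists_length_eq)
  have "?X \<subseteq> (\<lambda>(\<phi>, us). map \<phi> us) ` ?S"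
  proof clarify
    fix X \<phi> assume X: "set X \<subseteq> P" "length X = card (verts G)" and b: "bij_betw \<phi> (verts G) (set X)"
      and R: "\<forall>u v. {u, v} \<in> edges G \<longrightarrow> R (\<phi> u) (\<phi> v) = w {u, v}"
    let ?\<psi> = "restrict \<phi> (verts G)"
    \<comment> \<open>The vertices in the order in which their images occur in
      \<open>X\<close>.\<close>
    let ?us = "map (inv_into (verts G) \<phi>) X"
    have im: "\<phi> ` verts G = set X" and inj: "inj_on \<phi> (verts G)" using b unfolding bij_betw_def by auto
    have us: "?us \<in> ?U" using X im by (auto intro!: inv_into_into)
    have "?\<psi> u \<in> P" if "u \<in> verts G" for u using that im X by auto
    moreover have "R (?\<psi> u) (?\<psi> v) = w {u, v}" if "{u, v} \<in> edges G" for u v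
      using R that G[OF that] by auto
    ultimately have \<psi>: "?\<psi> \<in> embeddings R P w G"
      using inj unfolding embeddings_def by (auto simp: inj_on_restrict_eq)
    have "map ?\<psi> ?us = X"
      using im by (intro nth_equalityI) (auto simp: inv_into_into f_inv_into_f)
    then have "X = (\<lambda>(\<phi>, us). map \<phi> us) (?\<psi>, ?us)" by simp
    then show "X \<in> (\<lambda>(\<phi>, us). map \<phi> us) ` ?S"
      using us \<psi> by (intro image_eqI[of _ _ "(?\<psi>, ?us)"]) auto
  qed
  then have "card ?X \<le> card ((\<lambda>(\<phi>, us). map \<phi> us) ` ?S)"
    using finS by (intro card_mono finite_imageI)
  also have "\<dots> \<le> card ?S" using finS by (rule card_image_le)
  finally show ?thesis by (simp add: card_cartesian_product card_lists_length_eq V)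
qed

text \<open>Multiplying the bounds over the cover contributes the exponent \<open>4/3\<close> for
  each path on two vertices and \<open>2\<close> for each path on three.\<close>

lemma card_configs_covered:
  fixes R :: "'a \<Rightarrow> 'a \<Rightarrow> real" and G :: "'v graph"
  assumes G: "simple_graph G" "can_be_covered s t G" and K: "K \<ge> 0"
    and P: "finite P" "P \<noteq> {}"
    and pairs: "\<And>e. e \<in> edges G \<Longrightarrow>
      real (card {(x, y) \<in> P \<times> P. x \<noteq> y \<and> R x y = w e}) \<le> K * real (card P) powr (4/3)"
    and triples: "\<And>e e'. e \<in> edges G \<Longrightarrow> e' \<in> edges G \<Longrightarrow>
      real (card {(x, y, z) \<in> P \<times> P \<times> P. x \<noteq> y \<and> y \<noteq> z \<and> x \<noteq> z \<and> R x y = w e \<and> R y z = w e'})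
        \<le> K * real (card P) powr 2"
  shows "real (card {X. set X \<subseteq> P \<and> length X = card (verts G) \<and>
      (\<exists>\<phi>. bij_betw \<phi> (verts G) (set X) \<and>
        (\<forall>u v. {u, v} \<in> edges G \<longrightarrow> R (\<phi> u) (\<phi> v) = w {u, v}))})
    \<le> K ^ (s + t) * real (card (verts G)) ^ card (verts G) *
      real (card P) powr (4/3 * real s + 2 * real t)"
proof -
  let ?N = "real (card P)"
  have V: "finite (verts G)" and E: "\<And>e. e \<in> edges G \<Longrightarrow> e \<subseteq> verts G"
    using G(1) unfolding simple_graph_def by auto
  obtain A B where A: "finite A" "card A = s" "\<And>H. H \<in> A \<Longrightarrow> copy_in (path_graph 2) G H"
    and B: "finite B" "card B = t" "\<And>H. H \<in> B \<Longrightarrow> copy_in (path_graph 3) G H"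
    and cover: "(\<Union>H\<in>A \<union> B. verts H) = verts G"
    using G(2) unfolding can_be_covered_def by auto
  have "card (verts H) = 2" if "H \<in> A" for H
    using copy_in_path_2[OF A(3)[OF that]] by (metis card_2_iff)
  moreover have "card (verts H) = 3" if "H \<in> B" for H
    using copy_in_path_3[OF B(3)[OF that]] by (metis card_3_iff)
  \<comment> \<open>Members of \<open>A\<close> and \<open>B\<close> differ in their number of
    vertices; disjointness lets the product over the cover split.\<close>
  ultimately have disj: "A \<inter> B = {}" by force
  have sub: "subgraph H G" if "H \<in> A \<union> B" for H
    using that A(3) B(3) unfolding copy_in_def by blast
  have bA: "real (card (embeddings R P w H)) \<le> K * ?N powr (4/3)" if H: "H \<in> A" for H
  proof -
    obtain u v where uv: "u \<noteq> v" "verts H = {u, v}" "{u, v} \<in> edges H"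
      using copy_in_path_2[OF A(3)[OF H]] .
    have "{u, v} \<in> edges G" using uv sub[of H] H unfolding subgraph_def by blast+
    from pairs[OF this] of_nat_mono[OF card_embeddings_2[OF P(1) uv, of R w], where 'a = real]
    show ?thesis by linarith
  qed
  have bB: "real (card (embeddings R P w H)) \<le> K * ?N powr 2" if H: "H \<in> B" for H
  proof -
    obtain u v z where uv: "u \<noteq> v" "v \<noteq> z" "u \<noteq> z" "verts H = {u, v, z}" "{u, v} \<in> edges H" "{v, z} \<in> edges H"
      using copy_in_path_3[OF B(3)[OF H]] .
    have "{u, v} \<in> edges G" "{v, z} \<in> edges G" using uv sub[of H] H unfolding subgraph_def by blast+
    from triples[OF this] of_nat_mono[OF card_embeddings_3[OF P(1) uv, of R w], where 'a = real]
    show ?thesis by linarith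
  qed
  have N: "?N > 0" using P by (simp add: card_gt_0_iff)
  have "real (card (embeddings R P w G)) \<le> (\<Prod>H\<in>A \<union> B. real (card (embeddings R P w H)))"
    using of_nat_mono[OF card_embeddings_cover[OF P(1) V _ cover sub], where 'a = real] A(1) B(1)
    by simp
  also have "\<dots> = (\<Prod>H\<in>A. real (card (embeddings R P w H))) * (\<Prod>H\<in>B. real (card (embeddings R P w H)))"
    using A(1) B(1) disj by (rule prod.union_disjoint)
  also have "\<dots> \<le> (\<Prod>H\<in>A. K * ?N powr (4/3)) * (\<Prod>H\<in>B. K * ?N powr 2)"
    using bA bB K by (intro mult_mono prod_mono prod_nonneg) auto
  also have "\<dots> = K ^ (s + t) * ((?N powr (4/3)) ^ s * (?N powr 2) ^ t)"
    by (simp add: A(2) B(2) power_mult_distrib power_add)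
  also have "(?N powr (4/3)) ^ s * (?N powr 2) ^ t = ?N powr (4/3 * real s + 2 * real t)"
    using N by (simp add: powr_power powr_add mult.commute del: powr_numeral)
  finally have emb: "real (card (embeddings R P w G)) \<le> K ^ (s + t) * ?N powr (4/3 * real s + 2 * real t)" .
  have "real (card {X. set X \<subseteq> P \<and> length X = card (verts G) \<and>
      (\<exists>\<phi>. bij_betw \<phi> (verts G) (set X) \<and>
        (\<forall>u v. {u, v} \<in> edges G \<longrightarrow> R (\<phi> u) (\<phi> v) = w {u, v}))})
    \<le> real (card (embeddings R P w G)) * real (card (verts G)) ^ card (verts G)"
    using of_nat_mono[OF card_configs_le_embeddings[OF P(1) V E, where R = R and w = w], where 'a = real]
    by simp
  also have "\<dots> \<le> (K ^ (s + t) * ?N powr (4/3 * real s + 2 * real t)) * real (card (verts G)) ^ card (verts G)"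
    using emb by (intro mult_right_mono) auto
  finally show ?thesis by (simp add: ac_simps)
qed

theorem mainTheorem5:
  fixes G :: "'v graph" and w :: "'v set \<Rightarrow> real" and s t :: nat
  assumes "simple_graph G"
    and "can_be_covered s t G"
  shows "(\<lambda>n. real (max_distance_configs G w n)) \<lesssim> (\<lambda>n. real n powr (4/3 * real s + 2 * real t)) \<and>
    ((\<forall>e\<in>edges G. w e \<noteq> 0) \<longrightarrow>
      (\<lambda>n. real (max_dot_configs G w n)) \<lesssim> (\<lambda>n. real n powr (4/3 * real s + 2 * real t)))"
proof (intro conjI impI)
  \<comment> \<open>One factor \<open>16\<close> for each path of the cover, times the number of
    vertex lists.\<close>
  let ?C = "16 ^ (s + t) * real (card (verts G)) ^ card (verts G)"
  let ?b = "\<lambda>n. real n powr (4/3 * real s + 2 * real t)"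
  have nonempty: "P \<noteq> {}" if "card P = n" "n > 0" for P :: "(real^2) set" and n
    using that by auto
  show "(\<lambda>n. real (max_distance_configs G w n)) \<lesssim> ?b"
    unfolding lesssim_def
  \<comment> \<open>The threshold \<open>0\<close> makes the extremal point set nonempty, as
    \<open>card_configs_covered\<close> requires.\<close>
  proof (intro exI[of _ ?C] exI[of _ 0] allI impI)
    fix n :: nat assume n: "n > 0"
    obtain P where P: "finite P" "card P = n"
      and max: "max_distance_configs G w n = card {X. set X \<subseteq> P \<and> distance_config G w X}"
      using Max_in[OF distance_config_counts[of G w n]] unfolding max_distance_configs_def by blast
    show "real (max_distance_configs G w n) \<le> ?C * ?b n"
      unfolding max distance_config_def unfolding P(2)[symmetric]
      by (rule card_configs_covered[OF assms _ P(1) nonempty[OF P(2) n]])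
        (use card_distance_pairs[OF P(1)] card_distance_triples[OF P(1)] in auto)
  qed
  assume w: "\<forall>e\<in>edges G. w e \<noteq> 0"
  show "(\<lambda>n. real (max_dot_configs G w n)) \<lesssim> ?b"
    unfolding lesssim_def
  proof (intro exI[of _ ?C] exI[of _ 0] allI impI)
    fix n :: nat assume n: "n > 0"
    obtain P where P: "finite P" "card P = n"
      and max: "max_dot_configs G w n = card {X. set X \<subseteq> P \<and> dot_config G w X}"
      using Max_in[OF dot_config_counts[of G w n]] unfolding max_dot_configs_def by blast
    show "real (max_dot_configs G w n) \<le> ?C * ?b n"
      unfolding max dot_config_def unfolding P(2)[symmetric]
      by (rule card_configs_covered[OF assms _ P(1) nonempty[OF P(2) n]])
        (use card_dot_pairs[OF P(1)] card_dot_triples[OF P(1)] w in auto)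
  qed
qed

end
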